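(* Let $\Gamma$ be a weighted circular graph with $n\ge 6$ vertices containing exactly one vertex with weight $-1$. Then there exists a positive integer $a$ such that either $n=6$ and $\Gamma$ is isomorphic to $\Gamma(a)$, or $\Gamma$ is obtained from $\Gamma(a)$ by a uniquely determined sequence of combinatorial blow-ups $$\Gamma(a)=\Gamma^0\to\Gamma^1\to\cdots\to\Gamma^{n-7}\to\Gamma^{n-6}=\Gamma$$ such that every weighted circular graph $\Gamma^l$ ($0\le l\le n-6$) contains exactly $3$ vertices with weight at least $-1$: one vertex $\nu_i$ with weight $-1$, and two vertices $\nu_j,\nu_{j+1}$, neighbours of each other, with weights $\{w_j,w_{j+1}\}=\{0,a\}$. Moreover, the unique vertex of $\Gamma^l$ with weight $-1$ is never a neighbour of $\nu_j$ or of $\nu_{j+1}$.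
   Context: Weighted circular graphs. Let $N\cong\mathbb{Z}^2$. A complete regular $2$-dimensional fan $\Sigma$ in $N_{\mathbb{R}}$ has rays with primitive generators $\nu_i$ ($i\in\mathbb{Z}/n\mathbb{Z}$, $n\ge 3$) in cyclic order, and each pair $\nu_i,\nu_{i+1}$ is a $\mathbb{Z}$-basis of $N$. Its weighted circular graph $\Gamma$ is the cycle with vertices $\nu_i$ (neighbours $\nu_i,\nu_{i+1}$) and integer weights $w_i$ defined by $\nu_{i-1}+\nu_{i+1}+w_i\nu_i=0$. All weighted circular graphs considered arise from complete regular fans in this way, and isomorphism means isomorphism of weighted graphs. Combinatorial blow-up. Blowing up an edge $[\nu_i,\nu_{i+1}]$ means subdividing the cone $\mathbb{R}_{\ge0}\nu_i+\mathbb{R}_{\ge0}\nu_{i+1}$ by the new ray generated by $\nu'=\nu_i+\nu_{i+1}$; on weights, a new vertex of weight $-1$ is inserted between $\nu_i$ and $\nu_{i+1}$, the weights $w_i,w_{i+1}$ are each decreased by $1$, and all other weights are unchanged. For an integer $a\ge1$, $\Gamma(a)$ denotes the weighted circular graph with $6$ vertices whose weights in cyclic order are $(-1,-2,a,0,-a-1,-2)$. *)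

theory Defs
  imports "HOL-Analysis.Analysis"
begin

section \<open>Complete regular fans in the plane\<close>

text \<open>We take $N = \mathbb{Z}^2 \subseteq N_{\mathbb{R}} = \mathbb{R}^2$.\<close>

type_synonym plane = "real \<times> real"

definition lattice :: "plane set" where
  "lattice = \<int> \<times> \<int>"

definition lattice_basis :: "plane \<Rightarrow> plane \<Rightarrow> bool" where
  "lattice_basis u v \<longleftrightarrow> u \<in> lattice \<and> v \<in> lattice \<and>
     (\<forall>x\<in>lattice. \<exists>!(p, q). x = of_int p *\<^sub>R u + of_int q *\<^sub>R v)"

text \<open>A regular cone is generated by part of a lattice basis; in particular it is a strongly
  convex rational polyhedral cone. Note that \<^term>\<open>convex_cone hull {} = {0}\<close>.\<close>

definition regular_cone :: "plane set \<Rightarrow> bool" where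
  "regular_cone \<sigma> \<longleftrightarrow> (\<exists>u v B. lattice_basis u v \<and> B \<subseteq> {u, v} \<and> \<sigma> = convex_cone hull B)"

text \<open>The library relation \<^term>\<open>(face_of)\<close> also admits the empty set, which is not a face in the
  sense of polyhedral cones. All other instances of it are faces in that sense.\<close>

definition complete_regular_fan :: "plane set set \<Rightarrow> bool" where
  "complete_regular_fan \<Sigma> \<longleftrightarrow>
     finite \<Sigma> \<and>
     (\<forall>\<sigma>\<in>\<Sigma>. regular_cone \<sigma>) \<and>
     (\<forall>\<sigma>\<in>\<Sigma>. \<forall>\<tau>. \<tau> face_of \<sigma> \<and> \<tau> \<noteq> {} \<longrightarrow> \<tau> \<in> \<Sigma>) \<and>
     (\<forall>\<sigma>\<in>\<Sigma>. \<forall>\<tau>\<in>\<Sigma>. \<sigma> \<inter> \<tau> face_of \<sigma> \<and> \<sigma> \<inter> \<tau> face_of \<tau>) \<and>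
     \<Union>\<Sigma> = UNIV"

text \<open>The family $\nu$, indexed by $\mathbb{Z}/n\mathbb{Z}$ in the form of an $n$-periodic family
  over $\mathbb{Z}$, lists the ray generators of $\Sigma$ in cyclic order: the two-dimensional cones
  are those spanned by consecutive generators. The $\nu_i$ are primitive because they belong to
  lattice bases. Either of the two orientations is allowed.\<close>

definition cyclic_generators :: "plane set set \<Rightarrow> nat \<Rightarrow> (int \<Rightarrow> plane) \<Rightarrow> bool" where
  "cyclic_generators \<Sigma> n \<nu> \<longleftrightarrow>
     3 \<le> n \<and>
     (\<forall>i j. \<nu> i = \<nu> j \<longleftrightarrow> i mod int n = j mod int n) \<and>
     (\<forall>i. lattice_basis (\<nu> i) (\<nu> (i + 1))) \<and>
     \<Sigma> = {{0}} \<union> range (\<lambda>i. convex_cone hull {\<nu> i})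
             \<union> range (\<lambda>i. convex_cone hull {\<nu> i, \<nu> (i + 1)})"


section \<open>Weighted graphs\<close>

record 'v wgraph =
  verts :: "'v set"
  edges :: "'v set set"
  wt :: "'v \<Rightarrow> int"

definition wgraph_iso :: "'v wgraph \<Rightarrow> 'w wgraph \<Rightarrow> bool" where
  "wgraph_iso G H \<longleftrightarrow> (\<exists>f. bij_betw f (verts G) (verts H) \<and>
     (\<forall>x\<in>verts G. \<forall>y\<in>verts G. {x, y} \<in> edges G \<longleftrightarrow> {f x, f y} \<in> edges H) \<and>
     (\<forall>x\<in>verts G. wt H (f x) = wt G x))"

text \<open>The vertices are the ray generators themselves. Weights are set to 0 outside the
  vertex set so that a fan has exactly one weighted circular graph.\<close>

definition weighted_circular_graph :: "plane wgraph \<Rightarrow> bool" where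
  "weighted_circular_graph \<Gamma> \<longleftrightarrow> (\<exists>\<Sigma> n \<nu>. complete_regular_fan \<Sigma> \<and> cyclic_generators \<Sigma> n \<nu> \<and>
     verts \<Gamma> = range \<nu> \<and>
     edges \<Gamma> = range (\<lambda>i. {\<nu> i, \<nu> (i + 1)}) \<and>
     (\<forall>i. \<nu> (i - 1) + \<nu> (i + 1) + of_int (wt \<Gamma> (\<nu> i)) *\<^sub>R \<nu> i = 0) \<and>
     (\<forall>v. v \<notin> verts \<Gamma> \<longrightarrow> wt \<Gamma> v = 0))"

text \<open>The graph $\Gamma(a)$, with vertices numbered $0, \dots, 5$ in cyclic order.\<close>

definition Gamma_graph :: "int \<Rightarrow> nat wgraph" where
  "Gamma_graph a = \<lparr>verts = {..<6},
              edges = {{i, (i + 1) mod 6} | i. i < 6},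
              wt = (\<lambda>i. if i < 6 then [-1, -2, a, 0, -a - 1, -2] ! i else 0)\<rparr>"


section \<open>Combinatorial blow-ups\<close>

text \<open>Since the edges are the two-dimensional cones of the fan, replacing the edge $[u,v]$ by
  $[u,u+v]$ and $[u+v,v]$ is the subdivision of the cone spanned by $u$ and $v$ by the ray
  through $u+v$.\<close>

definition blow_up :: "plane wgraph \<Rightarrow> plane \<Rightarrow> plane \<Rightarrow> plane wgraph" where
  "blow_up G u v =
     \<lparr>verts = insert (u + v) (verts G),
      edges = (edges G - {{u, v}}) \<union> {{u, u + v}, {u + v, v}},
      wt = (wt G)(u := wt G u - 1, v := wt G v - 1, u + v := -1)\<rparr>"

definition is_blow_up :: "plane wgraph \<Rightarrow> plane wgraph \<Rightarrow> bool" where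
  "is_blow_up G G' \<longleftrightarrow> (\<exists>u v. {u, v} \<in> edges G \<and> G' = blow_up G u v)"

text \<open>A sequence $\Gamma(a) \cong \Gamma^0 \to \Gamma^1 \to \cdots \to \Gamma^m = \Gamma$ of
  weighted circular graphs and combinatorial blow-ups; $\Gamma^l$ is \<open>Gs ! l\<close>. The abstract
  graph $\Gamma(a)$ is matched with $\Gamma^0$ up to isomorphism, whereas the last term
  is $\Gamma$ itself, as a graph on lattice vectors.\<close>

definition blow_up_sequence :: "int \<Rightarrow> plane wgraph list \<Rightarrow> plane wgraph \<Rightarrow> bool" where
  "blow_up_sequence a Gs \<Gamma> \<longleftrightarrow>
     Gs \<noteq> [] \<and>
     (\<forall>G\<in>set Gs. weighted_circular_graph G) \<and>
     wgraph_iso (hd Gs) (Gamma_graph a) \<and>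
     last Gs = \<Gamma> \<and>
     (\<forall>l. Suc l < length Gs \<longrightarrow> is_blow_up (Gs ! l) (Gs ! Suc l))"

end

theory Submission
  imports Defs
begin

text \<open>A linear functional evaluated along the generators satisfies
  \<open>h (i - 1) + h (i + 1) = - w i * h i\<close>, so a first strict maximum of a positive functional has
  weight \<open>-1\<close>. This gives a vertex of weight \<open>-1\<close> inside every open half-plane that is bounded by
  two opposite generators and contains at least two generators, and then in every graph with at
  least five vertices.

  Let \<open>p\<close> be the unique vertex of weight \<open>-1\<close> and blow it down. The result has a vertex of weight
  \<open>-1\<close>, so some neighbour of \<open>p\<close> has weight \<open>-2\<close>. If both neighbours have weight \<open>-2\<close>, then the
  second neighbours of \<open>p\<close> are opposite, and for \<open>n \<ge> 7\<close> the half-plane that does not contain \<open>p\<close>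
  would have another vertex of weight \<open>-1\<close>. Hence for \<open>n \<ge> 7\<close> the blown down graph has again a
  unique vertex of weight \<open>-1\<close>, and one descends to \<open>n = 6\<close>, where the weights can be computed.
  A blow-up is determined by its result when the new vertex is the only one of weight \<open>-1\<close>.\<close>

section \<open>Plane cones\<close>

text \<open>The determinant of the pair. It gives coordinates by Cramer's rule, detects lattice
  bases by the values 1 and -1, and tells the sides of a line by its sign.\<close>

definition cross :: "plane \<Rightarrow> plane \<Rightarrow> real" where
  "cross u v = fst u * snd v - snd u * fst v"

lemma cross_add_left: "cross (u + v) w = cross u w + cross v w"
  and cross_add_right: "cross w (u + v) = cross w u + cross w v"
  and cross_diff_left: "cross (u - v) w = cross u w - cross v w"
  and cross_diff_right: "cross w (u - v) = cross w u - cross w v"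
  and cross_scaleR_left: "cross (c *\<^sub>R u) w = c * cross u w"
  and cross_scaleR_right: "cross w (c *\<^sub>R u) = c * cross w u"
  and cross_minus_left: "cross (- u) w = - cross u w"
  and cross_minus_right: "cross w (- u) = - cross w u"
  and cross_zero_left [simp]: "cross 0 w = 0"
  and cross_zero_right [simp]: "cross w 0 = 0"
  and cross_self [simp]: "cross u u = 0"
  by (auto simp: cross_def algebra_simps)

lemmas cross_simps = cross_add_left cross_add_right cross_diff_left cross_diff_right
  cross_scaleR_left cross_scaleR_right cross_minus_left cross_minus_right

lemma cross_commute: "cross v u = - cross u v"
  by (simp add: cross_def)

text \<open>Cramer's rule with the denominator cleared.\<close>

lemma cross_scaleR_eq: "cross u v *\<^sub>R x = cross x v *\<^sub>R u + cross u x *\<^sub>R v"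
  by (simp add: cross_def prod_eq_iff algebra_simps)

lemma cross_decompose:
  assumes "cross u v \<noteq> 0"
  shows "x = (cross x v / cross u v) *\<^sub>R u + (cross u x / cross u v) *\<^sub>R v"
proof -
  have "cross u v *\<^sub>R x = cross u v *\<^sub>R
      ((cross x v / cross u v) *\<^sub>R u + (cross u x / cross u v) *\<^sub>R v)"
    using assms cross_scaleR_eq[of u v x] by (simp add: scaleR_right_distrib)
  then show ?thesis using assms by simp
qed

lemma cross_eq_0_parallel:
  assumes "cross u v = 0" "u \<noteq> 0"
  obtains c where "v = c *\<^sub>R u"
proof -
  define n where "n = (fst u)\<^sup>2 + (snd u)\<^sup>2"
  have "n \<noteq> 0" using assms(2) by (auto simp: n_def prod_eq_iff sum_power2_eq_zero_iff)
  \<comment> \<open>The factor of the orthogonal projection of \<open>v\<close> to the line of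
    \<open>u\<close>; it recovers \<open>v\<close> because the determinant vanishes.\<close>
  have "n * fst v = (fst u * fst v + snd u * snd v) * fst u"
       "n * snd v = (fst u * fst v + snd u * snd v) * snd u"
    using assms(1) unfolding cross_def n_def by algebra+
  then have "v = ((fst u * fst v + snd u * snd v) / n) *\<^sub>R u"
    using \<open>n \<noteq> 0\<close> by (simp add: prod_eq_iff field_simps)
  then show thesis by (rule that)
qed

section \<open>Cones with two generators and their faces\<close>

lemma cone_hull_pair:
  "convex_cone hull {u, v} = {s *\<^sub>R u + t *\<^sub>R v | s t. 0 \<le> s \<and> 0 \<le> t}" (is "_ = ?C")
proof (rule hull_unique)
  have "u = 1 *\<^sub>R u + 0 *\<^sub>R v" "v = 0 *\<^sub>R u + 1 *\<^sub>R v" by auto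
  then show "{u, v} \<subseteq> ?C" by (smt (verit, ccfv_threshold) insert_iff mem_Collect_eq singletonD subsetI zero_le_one)
  show "convex_cone ?C"
    unfolding convex_cone_iff
  proof (intro conjI ballI allI impI)
    have "0 = 0 *\<^sub>R u + 0 *\<^sub>R v" by auto
    then show "0 \<in> ?C" by blast
  next
    fix x y assume "x \<in> ?C" "y \<in> ?C"
    then obtain s t s' t' where *: "0 \<le> s" "0 \<le> t" "0 \<le> s'" "0 \<le> t'"
      "x = s *\<^sub>R u + t *\<^sub>R v" "y = s' *\<^sub>R u + t' *\<^sub>R v" by blast
    then have "x + y = (s + s') *\<^sub>R u + (t + t') *\<^sub>R v" by (simp add: algebra_simps)
    with * show "x + y \<in> ?C" by (metis (mono_tags, lifting) add_nonneg_nonneg mem_Collect_eq)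
  next
    fix x c assume "x \<in> ?C" "(0::real) \<le> c"
    then obtain s t where *: "0 \<le> s" "0 \<le> t" "x = s *\<^sub>R u + t *\<^sub>R v" by blast
    then have "c *\<^sub>R x = (c * s) *\<^sub>R u + (c * t) *\<^sub>R v" by (simp add: algebra_simps)
    with * \<open>0 \<le> c\<close> show "c *\<^sub>R x \<in> ?C" by (metis (mono_tags, lifting) mult_nonneg_nonneg mem_Collect_eq)
  qed
next
  fix T :: "'a set" assume "{u, v} \<subseteq> T" "convex_cone T"
  then show "?C \<subseteq> T" by (auto intro!: convex_cone_add convex_cone_scaleR)
qed

lemma cone_hull_singleton: "convex_cone hull {u} = {s *\<^sub>R u | s. 0 \<le> s}"
proof -
  have "convex_cone hull {u} = {s *\<^sub>R u + t *\<^sub>R u | s t. 0 \<le> s \<and> 0 \<le> t}"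
    using cone_hull_pair[of u u] by simp
  also have "\<dots> = {s *\<^sub>R u | s. 0 \<le> s}"
  proof (safe)
    fix s t :: real assume "0 \<le> s" "0 \<le> t"
    then show "\<exists>r. s *\<^sub>R u + t *\<^sub>R u = r *\<^sub>R u \<and> 0 \<le> r"
      by (intro exI[of _ "s + t"]) (simp add: algebra_simps)
  next
    fix s :: real assume "0 \<le> s"
    then show "\<exists>r t. s *\<^sub>R u = r *\<^sub>R u + t *\<^sub>R u \<and> 0 \<le> r \<and> 0 \<le> t"
      by (intro exI[of _ s] exI[of _ 0]) simp
  qed
  finally show ?thesis .
qed

lemma cone_hull_pairI:
  "x = s *\<^sub>R u + t *\<^sub>R v \<Longrightarrow> 0 \<le> s \<Longrightarrow> 0 \<le> t \<Longrightarrow> x \<in> convex_cone hull {u, v}"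
  unfolding cone_hull_pair by blast

lemma cone_hull_pairE:
  assumes "x \<in> convex_cone hull {u, v}"
  obtains s t where "x = s *\<^sub>R u + t *\<^sub>R v" "0 \<le> s" "0 \<le> t"
  using assms unfolding cone_hull_pair by blast

text \<open>A face that contains a sum of two elements of the cone contains both summands. Hence it
  is generated by those of \<open>u\<close> and \<open>v\<close> that lie in it, which leaves four
  cases.\<close>

lemma face_of_cone_cases:
  fixes u v :: "'a::euclidean_space"
  assumes "\<tau> face_of convex_cone hull {u, v}" "\<tau> \<noteq> {}"
  shows "\<tau> \<in> {{0}, convex_cone hull {u}, convex_cone hull {v}, convex_cone hull {u, v}}"
proof -
  let ?C = "convex_cone hull {u, v}"
  have conic: "conic \<tau>" using face_of_conic[OF conic_convex_cone_hull assms(1)] .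
  have convex: "convex \<tau>" and sub: "\<tau> \<subseteq> ?C"
    using assms(1) by (blast intro: face_of_imp_convex dest: face_of_imp_subset)+
  have cone: "convex_cone \<tau>" using conic convex assms(2) by (simp add: convex_cone_def)
  have zero: "0 \<in> \<tau>" using cone by (rule convex_cone_contains_0)
  have half: "x \<in> \<tau> \<and> y \<in> \<tau>" if "x + y \<in> \<tau>" "x \<in> ?C" "y \<in> ?C" for x y
  proof (cases "x = y")
    case True
    have "x = (1/2) *\<^sub>R (x + y)" unfolding True by (metis scaleR_half_double)
    then show ?thesis using convex_cone_scaleR[OF cone, of "1/2" "x + y"] that True by simp
  next
    case False
    have "2 *\<^sub>R x \<in> ?C" "2 *\<^sub>R y \<in> ?C"
      using that by (auto intro!: convex_cone_scaleR convex_cone_convex_cone_hull)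
    \<comment> \<open>The sum is the midpoint of the doubled vectors. For \<open>x = y\<close> this
      open segment is empty, so that case is treated by scaling.\<close>
    moreover have "x + y \<in> open_segment (2 *\<^sub>R x) (2 *\<^sub>R y)"
      using False by (auto simp: in_segment intro!: exI[of _ "1/2"])
    ultimately have "2 *\<^sub>R x \<in> \<tau> \<and> 2 *\<^sub>R y \<in> \<tau>" using assms(1) that(1) unfolding face_of_def by blast
    then show ?thesis using convex_cone_scaleR[OF cone, of "1/2" "2 *\<^sub>R x"]
      convex_cone_scaleR[OF cone, of "1/2" "2 *\<^sub>R y"] by simp
  qed
  have uC: "s *\<^sub>R u \<in> ?C" and vC: "s *\<^sub>R v \<in> ?C" if "0 \<le> s" for s
    using that by (auto intro: convex_cone_scaleR convex_cone_convex_cone_hull hull_inc)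
  have scale: "x \<in> \<tau>" if "s *\<^sub>R x \<in> \<tau>" "0 < s" for s x
    using convex_cone_scaleR[OF cone, of "1/s" "s *\<^sub>R x"] that by simp
  have both: "\<tau> = ?C" if "u \<in> \<tau>" "v \<in> \<tau>"
    using sub that hull_minimal[of "{u, v}" \<tau> convex_cone] cone by blast
  have only: "x \<in> \<tau> \<Longrightarrow> \<exists>s t. x = s *\<^sub>R u + t *\<^sub>R v \<and> 0 \<le> s \<and> 0 \<le> t
      \<and> (s > 0 \<longrightarrow> u \<in> \<tau>) \<and> (t > 0 \<longrightarrow> v \<in> \<tau>)" for x
  proof -
    assume x: "x \<in> \<tau>"
    then obtain s t where st: "x = s *\<^sub>R u + t *\<^sub>R v" "0 \<le> s" "0 \<le> t"
      using sub cone_hull_pairE by blast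
    then have "s *\<^sub>R u \<in> \<tau> \<and> t *\<^sub>R v \<in> \<tau>" using half x uC vC by blast
    then show ?thesis using st scale by blast
  qed
  consider "u \<in> \<tau>" "v \<in> \<tau>" | "u \<in> \<tau>" "v \<notin> \<tau>" | "u \<notin> \<tau>" "v \<in> \<tau>" | "u \<notin> \<tau>" "v \<notin> \<tau>" by blast
  then show ?thesis
  proof cases
    case 1
    then show ?thesis using both by blast
  next
    case 2
    have "\<tau> = convex_cone hull {u}"
    proof
      show "\<tau> \<subseteq> convex_cone hull {u}"
        unfolding cone_hull_singleton using only 2(2) by (fastforce simp: order_le_less)
      show "convex_cone hull {u} \<subseteq> \<tau>" using 2(1) cone by (intro hull_minimal) auto
    qed
    then show ?thesis by blast
  next
    case 3
    have "\<tau> = convex_cone hull {v}"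
    proof
      show "\<tau> \<subseteq> convex_cone hull {v}"
        unfolding cone_hull_singleton using only 3(1) by (fastforce simp: order_le_less)
      show "convex_cone hull {v} \<subseteq> \<tau>" using 3(2) cone by (intro hull_minimal) auto
    qed
    then show ?thesis by blast
  next
    case 4
    have "\<tau> \<subseteq> {0}" using only 4 by (fastforce simp: order_le_less)
    then show ?thesis using zero by blast
  qed
qed

lemma cone_hull_pair_cross:
  assumes "cross u v \<noteq> 0"
  shows "x \<in> convex_cone hull {u, v} \<longleftrightarrow> 0 \<le> cross x v / cross u v \<and> 0 \<le> cross u x / cross u v"
proof
  assume "x \<in> convex_cone hull {u, v}"
  then obtain s t where "x = s *\<^sub>R u + t *\<^sub>R v" "0 \<le> s" "0 \<le> t" by (rule cone_hull_pairE)
  then show "0 \<le> cross x v / cross u v \<and> 0 \<le> cross u x / cross u v"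
    using assms by (simp add: cross_simps)
qed (auto intro: cone_hull_pairI[OF cross_decompose[OF assms]])

text \<open>A supporting line cuts out the ray: \<open>cross u v * cross u x\<close> is nonnegative
  on the cone and vanishes there only on the ray of \<open>u\<close>. The factor
  \<open>cross u v\<close> makes the sign independent of the orientation.\<close>

lemma ray_face_of_cone:
  assumes "cross u v \<noteq> 0"
  shows "convex_cone hull {u} face_of convex_cone hull {u, v}"
proof -
  have *: "cross u v * cross u x \<ge> 0" if "x \<in> convex_cone hull {u, v}" for x
    using that assms unfolding cone_hull_pair_cross[OF assms]
    by (simp add: zero_le_divide_iff zero_le_mult_iff) argo
  \<comment> \<open>The vector that represents this functional through the inner product.\<close>
  let ?a = "(- (cross u v * snd u), cross u v * fst u)"
  have a: "?a \<bullet> x = cross u v * cross u x" for x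
    by (cases x) (simp add: cross_def inner_prod_def algebra_simps)
  have "convex_cone hull {u, v} \<inter> {x. ?a \<bullet> x = 0} face_of convex_cone hull {u, v}"
    using * by (intro face_of_Int_supporting_hyperplane_ge convex_convex_cone_hull) (simp only: a)
  also have "convex_cone hull {u, v} \<inter> {x. ?a \<bullet> x = 0} = convex_cone hull {u}"
  proof (intro set_eqI iffI)
    fix x assume x: "x \<in> convex_cone hull {u, v} \<inter> {x. ?a \<bullet> x = 0}"
    then obtain s t where st: "x = s *\<^sub>R u + t *\<^sub>R v" "0 \<le> s" "0 \<le> t" by (auto elim: cone_hull_pairE)
    have "cross u x = 0" using x assms by (simp only: a Int_iff mem_Collect_eq) simp
    then have "t = 0" using st assms by (simp add: cross_simps)
    then show "x \<in> convex_cone hull {u}" using st by (auto simp: cone_hull_singleton)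
  next
    fix x assume "x \<in> convex_cone hull {u}"
    then obtain s where s: "x = s *\<^sub>R u" "0 \<le> s" by (auto simp: cone_hull_singleton)
    then have "?a \<bullet> x = 0" by (simp only: a cross_simps cross_self)
    moreover have "x \<in> convex_cone hull {u, v}" using s by (intro cone_hull_pairI[of _ s _ 0]) auto
    ultimately show "x \<in> convex_cone hull {u, v} \<inter> {x. ?a \<bullet> x = 0}" by blast
  qed
  finally show ?thesis .
qed

text \<open>The two boundary rays are faces, and they meet only in the origin.\<close>

lemma zero_face_of_cone:
  assumes "cross u v \<noteq> 0"
  shows "{0} face_of convex_cone hull {u, v}"
proof -
  have "cross v u \<noteq> 0" using assms cross_commute[of u v] by simp
  then have "convex_cone hull {u} \<inter> convex_cone hull {v} face_of convex_cone hull {u, v}"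
    using ray_face_of_cone[OF assms] ray_face_of_cone[of v u]
    by (intro face_of_Int) (simp_all add: insert_commute)
  also have "convex_cone hull {u} \<inter> convex_cone hull {v} = {0}"
  proof
    have "x = 0" if "x = s *\<^sub>R u" "x = t *\<^sub>R v" for x s t
    proof -
      have "s * cross u v = 0" using that cross_scaleR_left[of s u v] cross_scaleR_left[of t v v] by simp
      then show ?thesis using assms that by simp
    qed
    then show "convex_cone hull {u} \<inter> convex_cone hull {v} \<subseteq> {0}"
      by (auto simp: cone_hull_singleton)
  qed (auto simp: convex_cone_hull_contains_0)
  finally show ?thesis .
qed

section \<open>Lattice bases as unimodular pairs\<close>

lemma lattice_iff: "x \<in> lattice \<longleftrightarrow> fst x \<in> \<int> \<and> snd x \<in> \<int>"
  by (cases x) (simp add: lattice_def)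

lemma cross_lattice: "u \<in> lattice \<Longrightarrow> v \<in> lattice \<Longrightarrow> cross u v \<in> \<int>"
  by (auto simp: lattice_iff cross_def)

lemma Ints_mult_eq_1:
  assumes "a \<in> \<int>" "b \<in> \<int>" "a * b = (1::real)"
  shows "a = 1 \<or> a = -1"
proof -
  obtain p q where pq: "a = of_int p" "b = of_int q" using assms(1,2) by (auto elim!: Ints_cases)
  then have "p * q = 1" using assms(3) by (metis of_int_eq_1_iff of_int_mult)
  then have "p = 1 \<or> p = -1" using zmult_eq_1_iff by blast
  then show ?thesis using pq by auto
qed

text \<open>Expressing the standard basis in \<open>u\<close> and \<open>v\<close> gives an integer
  matrix whose determinant times \<open>cross u v\<close> is 1. Conversely, the quotients in
  Cramer's rule are integers when the denominator is 1 or -1.\<close>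

lemma lattice_basis_iff:
  "lattice_basis u v \<longleftrightarrow> u \<in> lattice \<and> v \<in> lattice \<and> (cross u v = 1 \<or> cross u v = -1)"
proof (intro iffI conjI)
  assume b: "lattice_basis u v"
  then show uv: "u \<in> lattice" "v \<in> lattice" by (simp_all add: lattice_basis_def)
  have "\<exists>p q. x = of_int p *\<^sub>R u + of_int q *\<^sub>R v" if "x \<in> lattice" for x
    using b that unfolding lattice_basis_def by blast
  moreover have "(1, 0) \<in> lattice" "(0, 1) \<in> lattice" by (auto simp: lattice_iff)
  ultimately obtain p q p' q' :: int where
    pq: "(1, 0) = of_int p *\<^sub>R u + of_int q *\<^sub>R v" "(0, 1) = of_int p' *\<^sub>R u + of_int q' *\<^sub>R v"
    by metis
  have "cross (1, 0) (0, 1) = of_int (p * q' - q * p') * cross u v"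
    unfolding pq by (simp add: cross_simps cross_commute[of u v] algebra_simps)
  then have "cross u v * of_int (p * q' - q * p') = 1" by (simp add: cross_def mult.commute)
  then show "cross u v = 1 \<or> cross u v = -1"
    by (rule Ints_mult_eq_1[OF cross_lattice[OF uv] Ints_of_int])
next
  assume uv: "u \<in> lattice \<and> v \<in> lattice \<and> (cross u v = 1 \<or> cross u v = -1)"
  then have nz: "cross u v \<noteq> 0" by auto
  have "\<exists>!(p, q). x = of_int p *\<^sub>R u + of_int q *\<^sub>R v" if x: "x \<in> lattice" for x
  proof -
    have "cross x v / cross u v \<in> \<int>" "cross u x / cross u v \<in> \<int>"
      using uv x by (auto simp: cross_lattice)
    then obtain p q where pq: "cross x v / cross u v = of_int p" "cross u x / cross u v = of_int q"
      by (auto elim!: Ints_cases)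
    have "x = of_int p *\<^sub>R u + of_int q *\<^sub>R v"
      using cross_decompose[OF nz, of x] by (simp only: pq)
    moreover have "r = p \<and> s = q" if "x = of_int r *\<^sub>R u + of_int s *\<^sub>R v" for r s
    proof -
      have "cross x v / cross u v = of_int r" "cross u x / cross u v = of_int s"
        using nz unfolding that by (simp_all add: cross_simps)
      then show ?thesis using pq by simp
    qed
    ultimately show ?thesis by (intro ex1I[of _ "(p, q)"]) auto
  qed
  then show "lattice_basis u v" using uv by (simp add: lattice_basis_def)
qed

section \<open>Circular graphs of fans\<close>

text \<open>Fixes the fan and the numbering whose existence \<open>weighted_circular_graph\<close>
  asserts. A change of numbering is then another interpretation for the same graph.\<close>

locale circular_graph =
  fixes \<Gamma> :: "plane wgraph" and \<Sigma> :: "plane set set" and n :: nat and \<nu> :: "int \<Rightarrow> plane"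
  assumes fan: "complete_regular_fan \<Sigma>"
    and generators: "cyclic_generators \<Sigma> n \<nu>"
    and verts_eq: "verts \<Gamma> = range \<nu>"
    and edges_eq: "edges \<Gamma> = range (\<lambda>i. {\<nu> i, \<nu> (i + 1)})"
    and weight: "\<nu> (i - 1) + \<nu> (i + 1) + of_int (wt \<Gamma> (\<nu> i)) *\<^sub>R \<nu> i = 0"
    and wt_outside: "v \<notin> verts \<Gamma> \<Longrightarrow> wt \<Gamma> v = 0"

lemma weighted_circular_graph_iff:
  "weighted_circular_graph \<Gamma> \<longleftrightarrow> (\<exists>\<Sigma> n \<nu>. circular_graph \<Gamma> \<Sigma> n \<nu>)"
  unfolding weighted_circular_graph_def circular_graph_def by blast

context circular_graph
begin

abbreviation w :: "int \<Rightarrow> int" where "w i \<equiv> wt \<Gamma> (\<nu> i)"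

lemma n_ge_3: "3 \<le> n"
  and nu_eq_mod: "\<nu> i = \<nu> j \<longleftrightarrow> i mod int n = j mod int n"
  and basis: "lattice_basis (\<nu> i) (\<nu> (i + 1))"
  and fan_eq: "\<Sigma> = {{0}} \<union> range (\<lambda>i. convex_cone hull {\<nu> i})
             \<union> range (\<lambda>i. convex_cone hull {\<nu> i, \<nu> (i + 1)})"
  using generators unfolding cyclic_generators_def by blast+

lemma nu_eq_iff: "\<nu> i = \<nu> j \<longleftrightarrow> int n dvd i - j"
  by (simp add: nu_eq_mod mod_eq_dvd_iff)

lemma nu_eq_shift: "\<nu> (i + c) = \<nu> (j + c) \<longleftrightarrow> \<nu> i = \<nu> j"
  by (simp add: nu_eq_iff)

lemma nu_neq: "0 < i - j \<Longrightarrow> i - j < int n \<Longrightarrow> \<nu> i \<noteq> \<nu> j"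
  by (auto simp: nu_eq_iff dest: zdvd_imp_le)

lemma nu_add_n: "\<nu> (i + int n) = \<nu> i"
  by (simp add: nu_eq_iff)

lemma nu_mod: "\<nu> (i mod int n) = \<nu> i" and nu_mod_Suc: "\<nu> (i mod int n + 1) = \<nu> (i + 1)"
  by (simp_all add: nu_eq_mod mod_add_left_eq)

lemma mod_n_less: "i mod int n \<in> {0..<int n}"
  using n_ge_3 by simp

lemma range_nu: "range \<nu> = \<nu> ` {0..<int n}"
proof -
  have "\<nu> i \<in> \<nu> ` {0..<int n}" for i using imageI[OF mod_n_less, of \<nu> i] by (simp only: nu_mod)
  then show ?thesis by auto
qed

lemma finite_verts: "finite (verts \<Gamma>)"
  by (simp add: verts_eq range_nu)

lemma card_verts: "card (verts \<Gamma>) = n"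
proof -
  have "inj_on \<nu> {0..<int n}" by (auto simp: inj_on_def nu_eq_mod)
  then show ?thesis by (simp add: verts_eq range_nu card_image)
qed

section \<open>Orientation and primitivity of the generators\<close>

lemma nu_in_lattice: "\<nu> i \<in> lattice"
  using basis[of i] by (simp add: lattice_basis_iff)

text \<open>Both directions of numbering are allowed. Multiplying determinants by this sign lets one
  argument serve for both.\<close>

definition orient :: real where "orient = cross (\<nu> 0) (\<nu> 1)"

lemma nu_Suc: "\<nu> (i + 1) = - of_int (w i) *\<^sub>R \<nu> i - \<nu> (i - 1)"
  using weight[of i] by (simp add: algebra_simps eq_neg_iff_add_eq_0)

text \<open>The recurrence for the generators replaces one consecutive pair by the next through a
  matrix of determinant 1.\<close>

lemma cross_Suc: "cross (\<nu> i) (\<nu> (i + 1)) = orient"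
proof -
  have step: "cross (\<nu> i) (\<nu> (i + 1)) = cross (\<nu> (i - 1)) (\<nu> i)" for i
    by (simp add: nu_Suc cross_simps cross_commute[of "\<nu> i"])
  show ?thesis
  proof (induction i rule: int_induct[of _ 0])
    case base
    then show ?case by (simp add: orient_def)
  next
    case (step1 i)
    then show ?case using step[of "i + 1"] by simp
  next
    case (step2 i)
    then show ?case using step[of i] by simp
  qed
qed

lemma orient_cases: "orient = 1 \<or> orient = -1"
  using basis[of 0] unfolding orient_def lattice_basis_iff by simp

lemma orient_square: "orient * orient = 1" and orient_nonzero: "orient \<noteq> 0"
  using orient_cases by auto

lemma nu_nonzero: "\<nu> i \<noteq> 0"
  using cross_Suc[of i] orient_nonzero by auto

text \<open>Pairing with the successor of \<open>\<nu> i\<close> writes 1 or -1 as \<open>s\<close>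
  times a nonzero integer, so the absolute value of \<open>s\<close> is at most 1. Exchanging the
  two generators bounds \<open>1/s\<close> in the same way.\<close>

lemma nu_primitive:
  assumes "\<nu> i = s *\<^sub>R \<nu> j" "0 < s"
  shows "\<nu> i = \<nu> j"
proof -
  have unit: "\<bar>s\<bar> \<le> 1" if "\<nu> i = s *\<^sub>R \<nu> j" for i j s
  proof -
    have "s * cross (\<nu> j) (\<nu> (i + 1)) = orient"
      using cross_Suc[of i] by (simp add: that cross_simps)
    then have "\<bar>s\<bar> * \<bar>cross (\<nu> j) (\<nu> (i + 1))\<bar> = 1"
      using orient_cases by (auto simp flip: abs_mult)
    moreover have "1 \<le> \<bar>cross (\<nu> j) (\<nu> (i + 1))\<bar>"
      using calculation by (intro Ints_nonzero_abs_ge1 cross_lattice nu_in_lattice) auto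
    ultimately show ?thesis
      using mult_left_mono[of 1 "\<bar>cross (\<nu> j) (\<nu> (i + 1))\<bar>" "\<bar>s\<bar>"] by simp
  qed
  have "\<nu> j = (1/s) *\<^sub>R \<nu> i" using assms by simp
  from unit[OF this] unit[OF assms(1)] assms(2) have "s = 1" by simp
  then show ?thesis using assms(1) by simp
qed

lemma nu_in_ray: "\<nu> k \<in> convex_cone hull {\<nu> i} \<longleftrightarrow> \<nu> k = \<nu> i"
proof
  assume "\<nu> k \<in> convex_cone hull {\<nu> i}"
  then obtain s where "\<nu> k = s *\<^sub>R \<nu> i" "0 \<le> s" by (auto simp: cone_hull_singleton)
  then show "\<nu> k = \<nu> i" using nu_primitive[of k s i] nu_nonzero[of k] by (cases "s = 0") auto
qed (simp add: hull_inc)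

text \<open>This is the only way in which the fan axioms enter the combinatorial arguments.\<close>

lemma nu_in_cone:
  "\<nu> k \<in> convex_cone hull {\<nu> i, \<nu> (i + 1)} \<longleftrightarrow> \<nu> k = \<nu> i \<or> \<nu> k = \<nu> (i + 1)"
proof
  let ?C = "convex_cone hull {\<nu> i, \<nu> (i + 1)}" and ?R = "convex_cone hull {\<nu> k}"
  assume k: "\<nu> k \<in> ?C"
  \<comment> \<open>Cones of a fan meet in a common face, and here the intersection is the ray
    itself.\<close>
  have "?R \<inter> ?C face_of ?C" using fan fan_eq unfolding complete_regular_fan_def by blast
  moreover have "?R \<subseteq> ?C" using k by (intro hull_minimal convex_cone_convex_cone_hull) auto
  ultimately have face: "?R face_of ?C" by (simp add: Int_absorb2)
  have "?R \<in> {{0}, convex_cone hull {\<nu> i}, convex_cone hull {\<nu> (i + 1)}, ?C}"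
    using face_of_cone_cases[OF face] convex_cone_hull_nonempty by blast
  moreover have kR: "\<nu> k \<in> ?R" by (simp add: hull_inc)
  moreover have "?R \<noteq> {0}" using kR nu_nonzero by auto
  moreover have "\<nu> i = \<nu> k \<and> \<nu> (i + 1) = \<nu> k" if "?R = ?C"
  proof -
    have "\<nu> i \<in> ?R" "\<nu> (i + 1) \<in> ?R" unfolding that by (simp_all add: hull_inc)
    then show ?thesis by (simp add: nu_in_ray)
  qed
  ultimately show "\<nu> k = \<nu> i \<or> \<nu> k = \<nu> (i + 1)"
    using nu_in_ray[of k i] nu_in_ray[of k "i + 1"] by (metis insert_iff singletonD)
qed (auto simp: hull_inc)

lemma edge_iff: "{\<nu> i, \<nu> j} \<in> edges \<Gamma> \<longleftrightarrow> \<nu> j = \<nu> (i + 1) \<or> \<nu> j = \<nu> (i - 1)"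
proof
  assume "{\<nu> i, \<nu> j} \<in> edges \<Gamma>"
  then obtain k where "{\<nu> i, \<nu> j} = {\<nu> k, \<nu> (k + 1)}" by (auto simp: edges_eq)
  then consider "\<nu> i = \<nu> k" "\<nu> j = \<nu> (k + 1)" | "\<nu> i = \<nu> (k + 1)" "\<nu> j = \<nu> k"
    by (auto simp: doubleton_eq_iff)
  then show "\<nu> j = \<nu> (i + 1) \<or> \<nu> j = \<nu> (i - 1)"
  proof cases
    case 1
    then show ?thesis using nu_eq_shift[of i 1 k] by simp
  next
    case 2
    then show ?thesis using nu_eq_shift[of i "-1" "k + 1"] by simp
  qed
next
  have "{\<nu> i, \<nu> (i + 1)} \<in> edges \<Gamma>" for i by (auto simp: edges_eq)
  from this[of i] this[of "i - 1"]
  show "\<nu> j = \<nu> (i + 1) \<or> \<nu> j = \<nu> (i - 1) \<Longrightarrow> {\<nu> i, \<nu> j} \<in> edges \<Gamma>"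
    by (auto simp: insert_commute)
qed

section \<open>Rotation and reflection of the numbering\<close>

lemma shifted: "circular_graph \<Gamma> \<Sigma> n (\<lambda>i. \<nu> (i + k))"
proof
  have rng: "range (\<lambda>i. f (i + k)) = range f" for f :: "int \<Rightarrow> 'a"
  proof -
    have "f ` range (\<lambda>i. i + k) = range f" by simp
    then show ?thesis by (simp only: image_image)
  qed
  show "complete_regular_fan \<Sigma>" by (rule fan)
  show "cyclic_generators \<Sigma> n (\<lambda>i. \<nu> (i + k))"
    unfolding cyclic_generators_def
  proof (intro conjI allI)
    show "\<Sigma> = {{0}} \<union> range (\<lambda>i. convex_cone hull {\<nu> (i + k)})
             \<union> range (\<lambda>i. convex_cone hull {\<nu> (i + k), \<nu> (i + 1 + k)})"
      using fan_eq rng[of "\<lambda>i. convex_cone hull {\<nu> i}"]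
        rng[of "\<lambda>i. convex_cone hull {\<nu> i, \<nu> (i + 1)}"] by (simp add: add.commute add.left_commute)
    show "lattice_basis (\<nu> (i + k)) (\<nu> (i + 1 + k))" for i
      using basis[of "i + k"] by (simp add: algebra_simps)
    show "\<nu> (i + k) = \<nu> (j + k) \<longleftrightarrow> i mod int n = j mod int n" for i j
      by (simp add: nu_eq_iff mod_eq_dvd_iff)
  qed (rule n_ge_3)
  show "verts \<Gamma> = range (\<lambda>i. \<nu> (i + k))" by (simp add: verts_eq rng)
  show "edges \<Gamma> = range (\<lambda>i. {\<nu> (i + k), \<nu> (i + 1 + k)})"
    using edges_eq rng[of "\<lambda>i. {\<nu> i, \<nu> (i + 1)}"] by (simp add: add.commute add.left_commute)
  show "\<nu> (i - 1 + k) + \<nu> (i + 1 + k) + of_int (wt \<Gamma> (\<nu> (i + k))) *\<^sub>R \<nu> (i + k) = 0" for i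
    using weight[of "i + k"] by (simp add: algebra_simps)
qed (rule wt_outside)

text \<open>Rotation moves a chosen vertex to index 0. Reflection then exchanges its two neighbours,
  so that arguments about one side transfer to the other.\<close>

lemma reflected: "circular_graph \<Gamma> \<Sigma> n (\<lambda>i. \<nu> (- i))"
proof
  have rng: "range (\<lambda>i. f (- i)) = range f" for f :: "int \<Rightarrow> 'a"
  proof -
    have "f ` range uminus = range f" by simp
    then show ?thesis by (simp only: image_image)
  qed
  have rng2: "range (\<lambda>i. f (- (i + 1))) = range f" for f :: "int \<Rightarrow> 'a"
  proof -
    have "range (\<lambda>i. f (- i - 1)) = f ` range (\<lambda>i. i - 1)"
      using rng[of "\<lambda>i. f (i - 1)"] by (simp only: image_image)
    then show ?thesis by simp
  qed
  show "complete_regular_fan \<Sigma>" by (rule fan)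
  show "cyclic_generators \<Sigma> n (\<lambda>i. \<nu> (- i))"
    unfolding cyclic_generators_def
  proof (intro conjI allI)
    show "\<Sigma> = {{0}} \<union> range (\<lambda>i. convex_cone hull {\<nu> (- i)})
             \<union> range (\<lambda>i. convex_cone hull {\<nu> (- i), \<nu> (- (i + 1))})"
      using fan_eq rng[of "\<lambda>i. convex_cone hull {\<nu> i}"]
        rng2[of "\<lambda>i. convex_cone hull {\<nu> i, \<nu> (i + 1)}"] by (simp add: insert_commute)
    show "lattice_basis (\<nu> (- i)) (\<nu> (- (i + 1)))" for i
      using basis[of "- (i + 1)"] by (simp add: lattice_basis_iff cross_commute[of "\<nu> (- i)"] disj_commute)
    show "\<nu> (- i) = \<nu> (- j) \<longleftrightarrow> i mod int n = j mod int n" for i j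
      by (simp add: nu_eq_iff mod_eq_dvd_iff dvd_diff_commute)
  qed (rule n_ge_3)
  show "verts \<Gamma> = range (\<lambda>i. \<nu> (- i))" by (simp add: verts_eq rng)
  show "edges \<Gamma> = range (\<lambda>i. {\<nu> (- i), \<nu> (- (i + 1))})"
    using edges_eq rng2[of "\<lambda>i. {\<nu> i, \<nu> (i + 1)}"] by (simp add: insert_commute)
  show "\<nu> (- (i - 1)) + \<nu> (- (i + 1)) + of_int (wt \<Gamma> (\<nu> (- i))) *\<^sub>R \<nu> (- i) = 0" for i
  proof -
    have eq: "- (i - 1) = - i + 1" "- (i + 1) = - i - 1" by simp_all
    show ?thesis unfolding eq using weight[of "- i"] by (simp only: add.commute[of "\<nu> (- i + 1)"])
  qed
qed (rule wt_outside)

end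

section \<open>Vertices of weight -1\<close>

text \<open>The first index at which \<open>h\<close> is maximal works: there the two neighbouring values have a
  positive sum that is less than twice the maximum.\<close>

lemma ex_weight_minus_one:
  fixes h :: "int \<Rightarrow> real" and w :: "int \<Rightarrow> int"
  assumes recurrence: "\<And>j. s < j \<Longrightarrow> j < t \<Longrightarrow> h (j - 1) + h (j + 1) = - of_int (w j) * h j"
    and pos: "\<And>j. s < j \<Longrightarrow> j < t \<Longrightarrow> 0 < h j"
    and sum_pos: "\<And>j. s < j \<Longrightarrow> j < t \<Longrightarrow> 0 < h (j - 1) + h (j + 1)"
    and k: "s < k" "k < t" "h s < h k" "h t \<le> h k"
  shows "\<exists>j. s < j \<and> j < t \<and> w j = -1"
proof -
  define M where "M = Max (h ` {s..t})"
  have le_M: "h j \<le> M" if "s \<le> j" "j \<le> t" for j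
    using that unfolding M_def by (intro Max_ge) auto
  have "M \<in> h ` {s..t}" unfolding M_def using k by (intro Max_in) auto
  then obtain i where i: "s \<le> i" "i \<le> t" "h i = M" by auto
  define J where "J = {j \<in> {s..t}. h j = M}"
  define j where "j = Min J"
  have "finite J" unfolding J_def by (rule finite_subset[of _ "{s..t}"]) auto
  moreover have "J \<noteq> {}" using i unfolding J_def by auto
  ultimately have "j \<in> J" and j_le: "\<And>l. l \<in> J \<Longrightarrow> j \<le> l" unfolding j_def by auto
  then have j: "s \<le> j" "j \<le> t" "h j = M" unfolding J_def by auto
  \<comment> \<open>The value at \<open>k\<close> exceeds the one at \<open>s\<close> and is at
    least the one at \<open>t\<close>, so the first maximum is at neither end.\<close>
  have "j \<noteq> s" using le_M[of k] k j by auto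
  moreover have "j \<noteq> t"
  proof
    assume "j = t"
    then have "k \<in> J" using le_M[of k] k j unfolding J_def by auto
    then show False using j_le k \<open>j = t\<close> by fastforce
  qed
  ultimately have jst: "s < j" "j < t" using j by auto
  have "h (j - 1) \<noteq> M" using j_le[of "j - 1"] jst unfolding J_def by auto
  then have "h (j - 1) < M" using le_M[of "j - 1"] jst by fastforce
  moreover have "h (j + 1) \<le> M" using le_M jst by simp
  ultimately have "- of_int (w j) * M < 2 * M" using recurrence[OF jst] j by simp
  moreover have "0 < - of_int (w j) * M" using recurrence[OF jst] sum_pos[OF jst] j by simp
  moreover have "0 < M" using pos[OF jst] j by simp
  ultimately have "0 < - w j" "- w j < 2"
    by (auto simp: zero_less_mult_iff mult_less_0_iff simp flip: of_int_minus)
  then show ?thesis using jst by (intro exI[of _ j]) auto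
qed

context circular_graph
begin

lemma linear_recurrence:
  assumes "linear f"
  shows "f (\<nu> (j - 1)) + f (\<nu> (j + 1)) = - of_int (w j) * (f (\<nu> j) :: real)"
proof -
  have "f (\<nu> (j - 1) + \<nu> (j + 1) + of_int (w j) *\<^sub>R \<nu> j) = 0"
    by (simp only: weight linear_0[OF assms])
  then show ?thesis by (simp add: linear_add[OF assms] linear_scale[OF assms])
qed

lemma linear_cross: "linear (cross u)"
  by (intro linearI) (simp_all add: cross_simps)

text \<open>Between two opposite generators the circle cannot cross the line that they span.\<close>

lemma halfplane_pos:
  assumes t: "t < s + int n" and opp: "\<nu> t = - \<nu> s" and j: "s < j" "j < t"
  shows "0 < orient * cross (\<nu> s) (\<nu> j)"
proof -
  have "s + 1 \<le> j" using j by simp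
  then have "j < t \<longrightarrow> 0 < orient * cross (\<nu> s) (\<nu> j)"
  proof (induction j rule: int_ge_induct)
    case base
    then show ?case by (simp add: cross_Suc orient_square)
  next
    case (step j)
    show ?case
    proof (rule impI, rule ccontr)
      let ?h = "\<lambda>x. orient * cross (\<nu> s) x"
      assume jt: "j + 1 < t" and "\<not> 0 < ?h (\<nu> (j + 1))"
      then have h1: "?h (\<nu> (j + 1)) \<le> 0" and h0: "0 < ?h (\<nu> j)" using step.IH by auto
      \<comment> \<open>The combination of the two consecutive generators that lies on the line of
        \<open>\<nu> s\<close>. Its coefficients are nonnegative because the two heights have
        different signs.\<close>
      define z where "z = (- ?h (\<nu> (j + 1))) *\<^sub>R \<nu> j + ?h (\<nu> j) *\<^sub>R \<nu> (j + 1)"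
      have zC: "z \<in> convex_cone hull {\<nu> j, \<nu> (j + 1)}"
        using h0 h1 by (intro cone_hull_pairI[OF z_def]) auto
      have "cross (\<nu> j) z = ?h (\<nu> j) * orient" by (simp add: z_def cross_simps cross_Suc)
      then have "z \<noteq> 0" using h0 orient_nonzero by auto
      have "cross (\<nu> s) z = 0" by (simp add: z_def cross_simps)
      then obtain c where c: "z = c *\<^sub>R \<nu> s" using nu_nonzero by (rule cross_eq_0_parallel)
      have C: "convex_cone (convex_cone hull {\<nu> j, \<nu> (j + 1)})" by (rule convex_cone_convex_cone_hull)
      \<comment> \<open>The sign of \<open>c\<close> decides on which of the two opposite rays
        \<open>z\<close> lies.\<close>
      have "\<nu> s \<in> convex_cone hull {\<nu> j, \<nu> (j + 1)} \<or> \<nu> t \<in> convex_cone hull {\<nu> j, \<nu> (j + 1)}"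
      proof (cases "0 < c")
        case True
        then have "\<nu> s = (1/c) *\<^sub>R z" using c by simp
        then show ?thesis using convex_cone_scaleR[OF C _ zC, of "1/c"] True by simp
      next
        case False
        then have "c < 0" using c \<open>z \<noteq> 0\<close> by (cases "c = 0") auto
        then have "\<nu> t = (- (1/c)) *\<^sub>R z" using c opp by simp
        then show ?thesis using convex_cone_scaleR[OF C _ zC, of "- (1/c)"] \<open>c < 0\<close> by simp
      qed
      then have "\<nu> s = \<nu> j \<or> \<nu> s = \<nu> (j + 1) \<or> \<nu> t = \<nu> j \<or> \<nu> t = \<nu> (j + 1)"
        using nu_in_cone by blast
      moreover have "\<nu> j \<noteq> \<nu> s" "\<nu> (j + 1) \<noteq> \<nu> s" "\<nu> t \<noteq> \<nu> j" "\<nu> t \<noteq> \<nu> (j + 1)"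
        using step.hyps jt t by (intro nu_neq; simp)+
      ultimately show False by metis
    qed
  qed
  then show ?thesis using j by blast
qed

text \<open>The height above the line of \<open>\<nu> s\<close> is 0 at both ends and positive
  between. The gap of 3 provides two generators between them, so every interior one has a neighbour
  of positive height; a single one would have weight 0.\<close>

lemma opposite_minus_one:
  assumes st: "s + 3 \<le> t" "t < s + int n" and opp: "\<nu> t = - \<nu> s"
  shows "\<exists>j. s < j \<and> j < t \<and> w j = -1"
proof (rule ex_weight_minus_one)
  let ?h = "\<lambda>j. orient * cross (\<nu> s) (\<nu> j)"
  have pos: "0 < ?h j" if "s < j" "j < t" for j using halfplane_pos[OF st(2) opp that] .
  show "?h (j - 1) + ?h (j + 1) = - of_int (w j) * ?h j" for j
    using linear_recurrence[OF linear_cross, of "\<nu> s" j] by (simp flip: distrib_left)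
  show "0 < ?h j" if "s < j" "j < t" for j using pos[OF that] .
  have hs: "?h s = 0" and ht: "?h t = 0" using opp by (simp_all add: cross_simps)
  show "0 < ?h (j - 1) + ?h (j + 1)" if "s < j" "j < t" for j
  proof (cases "j = s + 1")
    case True
    then show ?thesis using pos[of "j + 1"] hs st by simp
  next
    case False
    then have "0 < ?h (j - 1)" using that by (intro pos) auto
    moreover have "0 \<le> ?h (j + 1)" using pos[of "j + 1"] ht that by (cases "j + 1 = t") (auto simp: less_imp_le)
    ultimately show ?thesis by simp
  qed
  show "s < s + 1" "s + 1 < t" "?h s < ?h (s + 1)" "?h t \<le> ?h (s + 1)"
    using pos[of "s + 1"] hs ht st by auto
qed

text \<open>A generator of maximal norm works: its neighbours are distinct and not longer, so their
  sum is shorter than twice the generator.\<close>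

lemma ex_small_weight: "\<exists>i. w i \<in> {-1, 0, 1}"
proof -
  have fin: "finite (norm ` range \<nu>)" by (simp add: range_nu)
  have "Max (norm ` range \<nu>) \<in> norm ` range \<nu>" using fin by (intro Max_in) auto
  then obtain i where i: "norm (\<nu> i) = Max (norm ` range \<nu>)" by auto
  have max: "norm (\<nu> j) \<le> norm (\<nu> i)" for j unfolding i using fin by (intro Max_ge) auto
  let ?x = "\<nu> (i - 1)" and ?y = "\<nu> (i + 1)"
  have "?y \<noteq> ?x" using n_ge_3 by (intro nu_neq) auto
  then have "0 < (norm (?x - ?y))\<^sup>2" by simp
  \<comment> \<open>The parallelogram law; the bound becomes strict because the neighbours
    differ.\<close>
  moreover have "(norm (?x + ?y))\<^sup>2 + (norm (?x - ?y))\<^sup>2 = 2 * (norm ?x)\<^sup>2 + 2 * (norm ?y)\<^sup>2"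
    by (simp add: power2_norm_eq_inner algebra_simps inner_commute)
  moreover have "(norm ?x)\<^sup>2 \<le> (norm (\<nu> i))\<^sup>2" "(norm ?y)\<^sup>2 \<le> (norm (\<nu> i))\<^sup>2"
    using max by (auto intro: power_mono)
  moreover have "?x + ?y = (- of_int (w i)) *\<^sub>R \<nu> i"
    using weight[of i] by (simp add: eq_neg_iff_add_eq_0)
  then have "(norm (?x + ?y))\<^sup>2 = (of_int (w i))\<^sup>2 * (norm (\<nu> i))\<^sup>2" by (simp add: power_mult_distrib)
  ultimately have "(of_int (w i))\<^sup>2 * (norm (\<nu> i))\<^sup>2 < 4 * (norm (\<nu> i))\<^sup>2" by linarith
  then have "(of_int (w i))\<^sup>2 < (4::real)" by (simp add: mult_less_cancel_right)
  then have "(of_int (w i))\<^sup>2 < (2::real)\<^sup>2" by simp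
  then have "\<bar>w i\<bar> < 2" by (metis abs_le_square_iff abs_numeral not_le of_int_abs of_int_less_numeral_iff)
  then have "w i = -1 \<or> w i = 0 \<or> w i = 1" by linarith
  then show ?thesis by blast
qed

text \<open>Here \<open>\<nu> (i + 1)\<close>, \<open>\<nu> (i - 1)\<close> and \<open>\<nu> i\<close> sum to 0, so all other generators lie inside the
  cone spanned by the first two, and the sum \<open>f\<close> of the coordinates in that basis is larger on
  them than on the two boundary rays.\<close>

lemma weight_one_minus_one:
  assumes "4 \<le> n" "w i = 1"
  shows "\<exists>j. w j = -1"
proof -
  \<comment> \<open>Adding \<open>n\<close> makes the indices from \<open>s\<close> to
    \<open>t\<close> run once through all generators except \<open>\<nu> i\<close>.\<close>
  define s t where "s = i + 1" and "t = i - 1 + int n"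
  let ?a = "\<nu> s" and ?b = "\<nu> t" and ?z = "\<nu> i"
  have b: "?b = \<nu> (i - 1)" unfolding t_def by (rule nu_add_n)
  have z: "?z = - ?a - ?b" using weight[of i] assms(2) unfolding b s_def
    by (simp add: algebra_simps eq_neg_iff_add_eq_0)
  have ab: "cross ?a ?b = orient"
    using cross_Suc[of i] unfolding s_def[symmetric] by (simp add: z cross_simps cross_commute[of ?a])
  define f where "f x = orient * cross x ?b + orient * cross ?a x" for x
  have lin: "linear f" unfolding f_def by (intro linearI) (simp_all add: cross_simps algebra_simps)
  have f_ab: "f ?a = 1" "f ?b = 1" by (simp_all add: f_def ab orient_square)
  have f_ge: "2 \<le> f (\<nu> j)" if j: "s < j" "j < t" for j
  proof -
    define p q where "p = orient * cross (\<nu> j) ?b" and "q = orient * cross ?a (\<nu> j)"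
    have pq: "\<nu> j = p *\<^sub>R ?a + q *\<^sub>R ?b"
      using cross_decompose[of ?a ?b "\<nu> j"] orient_cases unfolding p_def q_def ab by auto
    have ints: "p \<in> \<int>" "q \<in> \<int>"
      using orient_cases cross_lattice[OF nu_in_lattice nu_in_lattice] unfolding p_def q_def by auto
    have neq: "\<nu> j \<noteq> ?a" "?b \<noteq> \<nu> j" "\<nu> j \<noteq> ?z"
      using j unfolding s_def t_def by (intro nu_neq; simp)+
    \<comment> \<open>Rewriting with \<open>?a = - ?b - ?z\<close> would place
      \<open>\<nu> j\<close> in the cone of \<open>?b\<close> and \<open>?z\<close>. The next claim
      is its mirror image with \<open>?z\<close> and \<open>?a\<close>.\<close>
    have not1: "\<not> (p \<le> q \<and> p < 0)"
    proof
      assume *: "p \<le> q \<and> p < 0"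
      have "\<nu> j = (q - p) *\<^sub>R \<nu> (i - 1) + (- p) *\<^sub>R \<nu> (i - 1 + 1)"
        unfolding pq by (simp add: z b algebra_simps)
      then have "\<nu> j \<in> convex_cone hull {\<nu> (i - 1), \<nu> (i - 1 + 1)}"
        by (rule cone_hull_pairI) (use * in auto)
      then show False using neq b unfolding nu_in_cone by auto
    qed
    have not2: "\<not> (q \<le> p \<and> q < 0)"
    proof
      assume *: "q \<le> p \<and> q < 0"
      have "\<nu> j = (- q) *\<^sub>R \<nu> i + (p - q) *\<^sub>R \<nu> (i + 1)"
        unfolding pq by (simp add: z s_def algebra_simps)
      then have "\<nu> j \<in> convex_cone hull {\<nu> i, \<nu> (i + 1)}"
        by (rule cone_hull_pairI) (use * in auto)
      then show False using neq s_def unfolding nu_in_cone by auto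
    qed
    \<comment> \<open>If a coordinate were negative, the smaller of the two would contradict one of
      the two claims.\<close>
    have nonneg: "0 \<le> p" "0 \<le> q" using not1 not2 by linarith+
    have "p \<noteq> 0"
    proof
      assume "p = 0"
      then have "\<nu> j \<in> convex_cone hull {?b}" using pq nonneg by (auto simp: cone_hull_singleton)
      then show False using neq nu_in_ray by metis
    qed
    moreover have "q \<noteq> 0"
    proof
      assume "q = 0"
      then have "\<nu> j \<in> convex_cone hull {?a}" using pq nonneg by (auto simp: cone_hull_singleton)
      then show False using neq nu_in_ray by metis
    qed
    ultimately have "1 \<le> p" "1 \<le> q"
      using ints nonneg by (metis Ints_nonzero_abs_ge1 abs_of_nonneg)+
    then show ?thesis by (simp add: f_def flip: p_def q_def)
  qed
  have f_pos: "0 < f (\<nu> j)" if "s \<le> j" "j \<le> t" for j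
    using f_ge[of j] f_ab that by (cases "j = s"; cases "j = t") auto
  have st: "s + 2 \<le> t" using assms unfolding s_def t_def by simp
  have "\<exists>j. s < j \<and> j < t \<and> w j = -1"
  proof (rule ex_weight_minus_one)
    show "f (\<nu> (j - 1)) + f (\<nu> (j + 1)) = - of_int (w j) * f (\<nu> j)" for j
      by (rule linear_recurrence[OF lin])
    show "0 < f (\<nu> j)" if "s < j" "j < t" for j using that by (intro f_pos) auto
    show "0 < f (\<nu> (j - 1)) + f (\<nu> (j + 1))" if "s < j" "j < t" for j
      using that by (intro add_pos_pos f_pos) auto
    show "s < s + 1" "s + 1 < t" "f ?a < f (\<nu> (s + 1))" "f ?b \<le> f (\<nu> (s + 1))"
      using f_ge[of "s + 1"] f_ab st by auto
  qed
  then show ?thesis by blast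
qed

text \<open>A vertex of weight 0 has opposite neighbours, and the way around that avoids it passes
  \<open>n - 3\<close> generators strictly between them, at least two for
  \<open>n >= 5\<close>.\<close>

lemma ex_minus_one:
  assumes "5 \<le> n"
  shows "\<exists>i. w i = -1"
proof -
  obtain i where "w i \<in> {-1, 0, 1}" using ex_small_weight by blast
  then consider "w i = -1" | "w i = 0" | "w i = 1" by blast
  then show ?thesis
  proof cases
    case 2
    have "\<nu> (i - 1 + int n) = - \<nu> (i + 1)"
      using weight[of i] 2 nu_add_n[of "i - 1"] by (simp add: eq_neg_iff_add_eq_0)
    then show ?thesis using opposite_minus_one[of "i + 1" "i - 1 + int n"] assms by auto
  next
    case 3
    then show ?thesis using weight_one_minus_one assms by simp
  qed blast
qed

end

section \<open>Blowing down\<close>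

text \<open>The removed vertex gets weight 0, the value prescribed outside the vertex set, so that
  blowing up can be inverted as an equality of records.\<close>

definition undo_blow_up :: "plane wgraph \<Rightarrow> plane \<Rightarrow> plane \<Rightarrow> plane wgraph" where
  "undo_blow_up G u v =
     \<lparr>verts = verts G - {u + v},
      edges = (edges G - {{u, u + v}, {u + v, v}}) \<union> {{u, v}},
      wt = (wt G)(u := wt G u + 1, v := wt G v + 1, u + v := 0)\<rparr>"

context circular_graph
begin

text \<open>Dropping \<open>\<nu> 0\<close> changes the period to \<open>n - 1\<close>. Residue 0
  stands for \<open>\<nu> 1\<close>, and residue \<open>n - 2\<close> for
  \<open>\<nu> (n - 1)\<close>, which is \<open>\<nu> (-1)\<close>.\<close>

definition down_nu :: "int \<Rightarrow> plane" where
  "down_nu i = \<nu> (1 + i mod int (n - 1))"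

definition down_cone :: "plane set" where
  "down_cone = convex_cone hull {\<nu> (-1), \<nu> 1}"

definition down_fan :: "plane set set" where
  "down_fan = {\<sigma> \<in> \<Sigma>. \<nu> 0 \<notin> \<sigma>} \<union> {down_cone}"

section \<open>Index computations for the remaining generators\<close>

lemma nu_pred_n: "\<nu> (int n - 1) = \<nu> (-1)" and nu_n: "\<nu> (int n) = \<nu> 0"
  using nu_add_n[of "-1"] nu_add_n[of 0] by simp_all

lemma mod_pred_n: "0 \<le> i mod int (n - 1)" "i mod int (n - 1) < int n - 1"
proof -
  have "0 < int (n - 1)" "int (n - 1) = int n - 1" using n_ge_3 by auto
  then show "0 \<le> i mod int (n - 1)" "i mod int (n - 1) < int n - 1"
    using pos_mod_sign pos_mod_bound by metis+
qed

lemma down_nu_step: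
  assumes "i mod int (n - 1) = r"
  shows "down_nu i = \<nu> (1 + r)"
    and "down_nu (i + 1) = (if r = int n - 2 then \<nu> 1 else \<nu> (2 + r))"
    and "down_nu (i - 1) = (if r = 0 then \<nu> (-1) else \<nu> r)"
proof -
  define m where "m = int (n - 1)"
  have m: "m = int n - 1" "2 \<le> m" using n_ge_3 by (auto simp: m_def)
  have r: "i mod m = r" "0 \<le> r" "r < m" using assms m by (auto simp flip: m_def)
  show "down_nu i = \<nu> (1 + r)" using assms by (simp add: down_nu_def)
  have "(i + 1) mod m = (r + 1) mod m" using r(1) by (metis mod_add_left_eq)
  also have "\<dots> = (if r = m - 1 then 0 else r + 1)" using r by auto
  finally show "down_nu (i + 1) = (if r = int n - 2 then \<nu> 1 else \<nu> (2 + r))"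
    using m by (auto simp: down_nu_def simp flip: m_def)
  have "(i - 1) mod m = (r - 1) mod m" using r(1) by (metis mod_diff_left_eq)
  also have "\<dots> = (if r = 0 then m - 1 else r - 1)" using r m by (auto simp: zmod_minus1 mod_pos_pos_trivial)
  finally show "down_nu (i - 1) = (if r = 0 then \<nu> (-1) else \<nu> r)"
    using m nu_pred_n by (auto simp: down_nu_def simp flip: m_def)
qed

lemma range_down_nu: "range (\<lambda>i. f (down_nu i)) = (\<lambda>j. f (\<nu> j)) ` {1..<int n}"
proof (intro equalityI subsetI)
  fix x assume "x \<in> range (\<lambda>i. f (down_nu i))"
  then obtain i where i: "x = f (\<nu> (1 + i mod int (n - 1)))" by (auto simp: down_nu_def)
  have "1 + i mod int (n - 1) \<in> {1..<int n}"
    using mod_pred_n[of i] unfolding atLeastLessThan_iff by linarith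
  with i show "x \<in> (\<lambda>j. f (\<nu> j)) ` {1..<int n}" by blast
next
  fix x assume "x \<in> (\<lambda>j. f (\<nu> j)) ` {1..<int n}"
  then obtain j where j: "x = f (\<nu> j)" "1 \<le> j" "j < int n" by auto
  then have "f (down_nu (j - 1)) = x" by (simp add: down_nu_def)
  then show "x \<in> range (\<lambda>i. f (down_nu i))" by blast
qed

text \<open>The function \<open>f\<close> is arbitrary so that one computation serves for cones,
  edges and lattice bases.\<close>

lemma range_down_nu_pairs:
  "range (\<lambda>i. f (down_nu i) (down_nu (i + 1)))
    = insert (f (\<nu> (-1)) (\<nu> 1)) ((\<lambda>j. f (\<nu> j) (\<nu> (j + 1))) ` {1..<int n - 1})" (is "?L = ?R")
proof (intro equalityI subsetI)
  fix x assume "x \<in> ?L"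
  then obtain i where i: "x = f (down_nu i) (down_nu (i + 1))" by auto
  define r where "r = i mod int (n - 1)"
  have r: "0 \<le> r" "r < int n - 1" using mod_pred_n[of i] by (simp_all add: r_def)
  note step = down_nu_step[of i r, OF r_def[symmetric]]
  show "x \<in> ?R"
  proof (cases "r = int n - 2")
    case True
    then show ?thesis using i step nu_pred_n by simp
  next
    case False
    then have "x = f (\<nu> (r + 1)) (\<nu> (r + 1 + 1))" using i step by (simp add: add.commute)
    moreover have "r + 1 \<in> {1..<int n - 1}" using r False by simp
    ultimately show ?thesis by blast
  qed
next
  have *: "f (down_nu i) (down_nu (i + 1)) \<in> ?L" for i by blast
  fix x assume "x \<in> ?R"
  then consider "x = f (\<nu> (-1)) (\<nu> 1)" | j where "x = f (\<nu> j) (\<nu> (j + 1))" "1 \<le> j" "j < int n - 1" by auto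
  then show "x \<in> ?L"
  proof cases
    case 1
    have "(int n - 2) mod int (n - 1) = int n - 2" using n_ge_3 by simp
    from down_nu_step(1,2)[OF this] show ?thesis using 1 *[of "int n - 2"] nu_pred_n by simp
  next
    case 2
    have "(j - 1) mod int (n - 1) = j - 1" using 2 n_ge_3 by simp
    from down_nu_step(1,2)[OF this] show ?thesis using 2 *[of "j - 1"] by (simp add: add.commute)
  qed
qed

lemma range_nu_pairs:
  "range (\<lambda>i. f (\<nu> i) (\<nu> (i + 1))) = (\<lambda>j. f (\<nu> j) (\<nu> (j + 1))) ` {0..<int n}"
proof (intro equalityI subsetI)
  fix x assume "x \<in> range (\<lambda>i. f (\<nu> i) (\<nu> (i + 1)))"
  then obtain i where "x = f (\<nu> i) (\<nu> (i + 1))" by auto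
  then have "x = f (\<nu> (i mod int n)) (\<nu> (i mod int n + 1))" by (simp only: nu_mod nu_mod_Suc)
  then show "x \<in> (\<lambda>j. f (\<nu> j) (\<nu> (j + 1))) ` {0..<int n}" using mod_n_less by blast
qed auto

lemma range_nu_pairs_split:
  "range (\<lambda>i. f (\<nu> i) (\<nu> (i + 1)))
    = {f (\<nu> (-1)) (\<nu> 0), f (\<nu> 0) (\<nu> 1)} \<union> (\<lambda>j. f (\<nu> j) (\<nu> (j + 1))) ` {1..<int n - 1}"
proof -
  have "{0..<int n} = {int n - 1, 0} \<union> {1..<int n - 1}" using n_ge_3 by auto
  then show ?thesis unfolding range_nu_pairs by (simp add: nu_pred_n nu_n)
qed

lemma middle_neq: "1 \<le> j \<Longrightarrow> j < int n \<Longrightarrow> \<nu> j \<noteq> \<nu> 0"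
  by (intro nu_neq) auto

lemma neighbours_distinct: "\<nu> (-1) \<noteq> \<nu> 0" "\<nu> 1 \<noteq> \<nu> 0" "\<nu> (-1) \<noteq> \<nu> 1"
  using nu_neq[of 0 "-1"] nu_neq[of 1 0] nu_neq[of 1 "-1"] n_ge_3 by auto

end

text \<open>Four vertices leave the three that \<open>cyclic_generators\<close> demands after the
  blow-down.\<close>

locale blow_down = circular_graph +
  assumes n_ge_4: "4 \<le> n" and w_0: "w 0 = -1"
begin

lemma nu_0: "\<nu> 0 = \<nu> (-1) + \<nu> 1"
  using weight[of 0] w_0 by simp

definition down_graph :: "plane wgraph" where
  "down_graph = undo_blow_up \<Gamma> (\<nu> (-1)) (\<nu> 1)"

lemma down_graph_eq:
  "down_graph = \<lparr>verts = verts \<Gamma> - {\<nu> 0},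
     edges = (edges \<Gamma> - {{\<nu> (-1), \<nu> 0}, {\<nu> 0, \<nu> 1}}) \<union> {{\<nu> (-1), \<nu> 1}},
     wt = (wt \<Gamma>)(\<nu> (-1) := w (-1) + 1, \<nu> 1 := w 1 + 1, \<nu> 0 := 0)\<rparr>"
  by (simp add: down_graph_def undo_blow_up_def flip: nu_0)

text \<open>This is why removing a ray of weight -1 keeps the fan regular: the outer two generators
  again form a lattice basis.\<close>

lemma cross_neighbours: "cross (\<nu> (-1)) (\<nu> 1) = orient"
  using cross_Suc[of 0] by (simp add: nu_0 cross_simps)

lemma cross_neighbours_nonzero: "cross (\<nu> (-1)) (\<nu> 1) \<noteq> 0"
  by (simp add: cross_neighbours orient_nonzero)

lemma nu_0_in_down_cone: "\<nu> 0 \<in> down_cone"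
  unfolding down_cone_def by (rule cone_hull_pairI[of _ 1 _ 1]) (simp_all add: nu_0)

section \<open>The fan without the ray of \<open>\<nu> 0\<close>\<close>

lemma fan_containing_nu_0:
  assumes "\<sigma> \<in> \<Sigma>" "\<nu> 0 \<in> \<sigma>"
  shows "\<sigma> \<in> {convex_cone hull {\<nu> 0}, convex_cone hull {\<nu> (-1), \<nu> 0}, convex_cone hull {\<nu> 0, \<nu> 1}}"
proof -
  consider "\<sigma> = {0}" | i where "\<sigma> = convex_cone hull {\<nu> i}"
    | "\<sigma> \<in> range (\<lambda>i. convex_cone hull {\<nu> i, \<nu> (i + 1)})"
    using assms(1) unfolding fan_eq by blast
  then show ?thesis
  proof cases
    case 1
    then show ?thesis using assms(2) nu_nonzero by simp
  next
    case 2
    then show ?thesis using assms(2) nu_in_ray by auto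
  next
    case 3
    then consider "\<sigma> \<in> {convex_cone hull {\<nu> (-1), \<nu> 0}, convex_cone hull {\<nu> 0, \<nu> 1}}"
      | j where "\<sigma> = convex_cone hull {\<nu> j, \<nu> (j + 1)}" "1 \<le> j" "j < int n - 1"
      unfolding range_nu_pairs_split[of "\<lambda>x y. convex_cone hull {x, y}"] by auto
    then show ?thesis
    proof cases
      case 2
      then have "\<nu> 0 = \<nu> j \<or> \<nu> 0 = \<nu> (j + 1)" using assms(2) nu_in_cone by simp
      moreover have "\<nu> j \<noteq> \<nu> 0" "\<nu> (j + 1) \<noteq> \<nu> 0" using 2 by (intro middle_neq; simp)+
      ultimately show ?thesis by metis
    qed auto
  qed
qed

text \<open>The smaller of the two coordinates can be taken off both, as a multiple of
  \<open>\<nu> 0\<close>; what remains lies on one outer ray.\<close>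

lemma subdivided_cone:
  "down_cone = convex_cone hull {\<nu> (-1), \<nu> 0} \<union> convex_cone hull {\<nu> 0, \<nu> 1}"
proof (intro equalityI subsetI)
  fix x assume "x \<in> down_cone"
  then obtain s t where st: "x = s *\<^sub>R \<nu> (-1) + t *\<^sub>R \<nu> 1" "0 \<le> s" "0 \<le> t"
    unfolding down_cone_def by (rule cone_hull_pairE)
  show "x \<in> convex_cone hull {\<nu> (-1), \<nu> 0} \<union> convex_cone hull {\<nu> 0, \<nu> 1}"
  proof (cases "t \<le> s")
    case True
    have "x = (s - t) *\<^sub>R \<nu> (-1) + t *\<^sub>R \<nu> 0" by (simp add: st nu_0 algebra_simps)
    then have "x \<in> convex_cone hull {\<nu> (-1), \<nu> 0}"
      by (rule cone_hull_pairI) (use True st in auto)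
    then show ?thesis by blast
  next
    case False
    have "x = s *\<^sub>R \<nu> 0 + (t - s) *\<^sub>R \<nu> 1" by (simp add: st nu_0 algebra_simps)
    then have "x \<in> convex_cone hull {\<nu> 0, \<nu> 1}"
      by (rule cone_hull_pairI) (use False st in auto)
    then show ?thesis by blast
  qed
next
  have gen: "{\<nu> (-1), \<nu> 0, \<nu> 1} \<subseteq> down_cone"
    using nu_0_in_down_cone unfolding down_cone_def by (auto simp: hull_inc)
  have "convex_cone down_cone" unfolding down_cone_def by (rule convex_cone_convex_cone_hull)
  then have "convex_cone hull {\<nu> (-1), \<nu> 0} \<subseteq> down_cone" "convex_cone hull {\<nu> 0, \<nu> 1} \<subseteq> down_cone"
    using gen by (simp_all add: hull_minimal)
  then show "x \<in> down_cone" if "x \<in> convex_cone hull {\<nu> (-1), \<nu> 0} \<union> convex_cone hull {\<nu> 0, \<nu> 1}" for x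
    using that by blast
qed

lemma pieces_in_fan: "convex_cone hull {\<nu> (-1), \<nu> 0} \<in> \<Sigma>" "convex_cone hull {\<nu> 0, \<nu> 1} \<in> \<Sigma>"
proof -
  have "convex_cone hull {\<nu> i, \<nu> (i + 1)} \<in> \<Sigma>" for i unfolding fan_eq by blast
  from this[of "-1"] this[of 0]
  show "convex_cone hull {\<nu> (-1), \<nu> 0} \<in> \<Sigma>" "convex_cone hull {\<nu> 0, \<nu> 1} \<in> \<Sigma>" by simp_all
qed

lemma faces_of_down_cone:
  "{0} face_of down_cone" "convex_cone hull {\<nu> (-1)} face_of down_cone"
  "convex_cone hull {\<nu> 1} face_of down_cone"
  unfolding down_cone_def
  using zero_face_of_cone[OF cross_neighbours_nonzero] ray_face_of_cone[OF cross_neighbours_nonzero]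
    ray_face_of_cone[of "\<nu> 1" "\<nu> (-1)"] cross_neighbours_nonzero cross_commute[of "\<nu> 1" "\<nu> (-1)"]
  by (auto simp: insert_commute)

text \<open>A cone of the fan that avoids \<open>\<nu> 0\<close> meets each of the two pieces in \<open>{0}\<close> or in an outer
  ray. It cannot meet them in both outer rays, because then it would contain
  \<open>\<nu> 0 = \<nu> (-1) + \<nu> 1\<close>.\<close>

lemma down_cone_Int_face:
  assumes \<tau>: "\<tau> \<in> \<Sigma>" "\<nu> 0 \<notin> \<tau>"
  shows "down_cone \<inter> \<tau> face_of down_cone" "down_cone \<inter> \<tau> face_of \<tau>"
proof -
  let ?A = "convex_cone hull {\<nu> (-1), \<nu> 0}" and ?B = "convex_cone hull {\<nu> 0, \<nu> 1}"
  have "regular_cone \<tau>" using fan \<tau> unfolding complete_regular_fan_def by blast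
  then have cone: "convex_cone \<tau>" unfolding regular_cone_def by (auto intro: convex_cone_convex_cone_hull)
  have faces: "?A \<inter> \<tau> face_of ?A" "?A \<inter> \<tau> face_of \<tau>" "?B \<inter> \<tau> face_of ?B" "?B \<inter> \<tau> face_of \<tau>"
    using fan pieces_in_fan \<tau> unfolding complete_regular_fan_def by blast+
  have zero: "0 \<in> ?A \<inter> \<tau>" "0 \<in> ?B \<inter> \<tau>"
    using convex_cone_contains_0[OF cone] by (auto simp: convex_cone_hull_contains_0)
  have hull_0: "\<nu> 0 \<in> convex_cone hull {\<nu> 0}" "\<nu> 0 \<in> ?A" "\<nu> 0 \<in> ?B" by (auto simp: hull_inc)
  have A: "?A \<inter> \<tau> = {0} \<or> ?A \<inter> \<tau> = convex_cone hull {\<nu> (-1)}"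
    using face_of_cone_cases[OF faces(1)] zero \<tau>(2) hull_0 by blast
  have B: "?B \<inter> \<tau> = {0} \<or> ?B \<inter> \<tau> = convex_cone hull {\<nu> 1}"
    using face_of_cone_cases[OF faces(3)] zero \<tau>(2) hull_0 by blast
  have not_both: "\<not> (?A \<inter> \<tau> = convex_cone hull {\<nu> (-1)} \<and> ?B \<inter> \<tau> = convex_cone hull {\<nu> 1})"
  proof
    assume "?A \<inter> \<tau> = convex_cone hull {\<nu> (-1)} \<and> ?B \<inter> \<tau> = convex_cone hull {\<nu> 1}"
    then have "\<nu> (-1) \<in> \<tau>" "\<nu> 1 \<in> \<tau>"
      using hull_inc[of "\<nu> (-1)" "{\<nu> (-1)}" convex_cone] hull_inc[of "\<nu> 1" "{\<nu> 1}" convex_cone] by auto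
    then show False using convex_cone_add[OF cone] nu_0 \<tau>(2) by simp
  qed
  have Int: "down_cone \<inter> \<tau> = (?A \<inter> \<tau>) \<union> (?B \<inter> \<tau>)" unfolding subdivided_cone by blast
  consider "?A \<inter> \<tau> = {0}" | "?B \<inter> \<tau> = {0}" using A B not_both by blast
  then have "down_cone \<inter> \<tau> = ?A \<inter> \<tau> \<or> down_cone \<inter> \<tau> = ?B \<inter> \<tau>"
  proof cases
    case 1
    then show ?thesis using Int zero(2) by (simp add: insert_absorb)
  next
    case 2
    then show ?thesis using Int zero(1) by (simp add: insert_absorb)
  qed
  then show "down_cone \<inter> \<tau> face_of down_cone" "down_cone \<inter> \<tau> face_of \<tau>"
    using A B faces(2,4) faces_of_down_cone by metis+
qed

lemma down_basis: "lattice_basis (\<nu> (-1)) (\<nu> 1)"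
  using orient_cases by (simp add: lattice_basis_iff nu_in_lattice cross_neighbours)

text \<open>Only \<open>down_cone\<close> needs new arguments. Its proper faces are old cones that
  avoid \<open>\<nu> 0\<close>, its intersections are given by \<open>down_cone_Int_face\<close>,
  and it covers every removed cone.\<close>

lemma complete_regular_fan_down: "complete_regular_fan down_fan"
  unfolding complete_regular_fan_def
proof (intro conjI ballI allI impI)
  have *: "\<And>\<sigma>. \<sigma> \<in> \<Sigma> \<Longrightarrow> regular_cone \<sigma>" "\<And>\<sigma> \<tau>. \<sigma> \<in> \<Sigma> \<Longrightarrow> \<tau> face_of \<sigma> \<Longrightarrow> \<tau> \<noteq> {} \<Longrightarrow> \<tau> \<in> \<Sigma>"
    "\<And>\<sigma> \<tau>. \<sigma> \<in> \<Sigma> \<Longrightarrow> \<tau> \<in> \<Sigma> \<Longrightarrow> \<sigma> \<inter> \<tau> face_of \<sigma> \<and> \<sigma> \<inter> \<tau> face_of \<tau>"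
    "finite \<Sigma>" "\<Union>\<Sigma> = UNIV"
    using fan unfolding complete_regular_fan_def by blast+
  show "finite down_fan" unfolding down_fan_def using *(4) by auto
  have "regular_cone down_cone" unfolding regular_cone_def down_cone_def using down_basis by blast
  then show "regular_cone \<sigma>" if "\<sigma> \<in> down_fan" for \<sigma> using that *(1) unfolding down_fan_def by blast
  have ray: "convex_cone hull {\<nu> i} \<in> \<Sigma>" for i unfolding fan_eq by blast
  show "\<tau> \<in> down_fan" if "\<sigma> \<in> down_fan" "\<tau> face_of \<sigma> \<and> \<tau> \<noteq> {}" for \<sigma> \<tau>
  proof (cases "\<sigma> = down_cone")
    case False
    then have "\<sigma> \<in> \<Sigma>" "\<nu> 0 \<notin> \<sigma>" using that unfolding down_fan_def by auto
    then show ?thesis using that *(2) face_of_imp_subset unfolding down_fan_def by blast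
  next
    case True
    then have "\<tau> \<in> {{0}, convex_cone hull {\<nu> (-1)}, convex_cone hull {\<nu> 1}, down_cone}"
      using that face_of_cone_cases unfolding down_cone_def by blast
    then show ?thesis
      using ray nu_in_ray[of 0 "-1"] nu_in_ray[of 0 1] neighbours_distinct nu_nonzero fan_eq
      unfolding down_fan_def by auto
  qed
  show "\<sigma> \<inter> \<tau> face_of \<sigma>" "\<sigma> \<inter> \<tau> face_of \<tau>" if "\<sigma> \<in> down_fan" "\<tau> \<in> down_fan" for \<sigma> \<tau>
  proof -
    have "\<sigma> \<inter> \<tau> face_of \<sigma> \<and> \<sigma> \<inter> \<tau> face_of \<tau>"
    proof (cases "\<sigma> = down_cone"; cases "\<tau> = down_cone")
      assume "\<sigma> = down_cone" "\<tau> = down_cone"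
      then show ?thesis by (simp add: face_of_refl down_cone_def convex_convex_cone_hull)
    next
      assume "\<sigma> = down_cone" "\<tau> \<noteq> down_cone"
      then show ?thesis using that down_cone_Int_face[of \<tau>] unfolding down_fan_def by auto
    next
      assume "\<sigma> \<noteq> down_cone" "\<tau> = down_cone"
      then show ?thesis using that down_cone_Int_face[of \<sigma>] unfolding down_fan_def by (auto simp: Int_commute)
    next
      assume "\<sigma> \<noteq> down_cone" "\<tau> \<noteq> down_cone"
      then show ?thesis using that *(3) unfolding down_fan_def by auto
    qed
    then show "\<sigma> \<inter> \<tau> face_of \<sigma>" "\<sigma> \<inter> \<tau> face_of \<tau>" by blast+
  qed
  have "x \<in> \<Union>down_fan" for x
  proof -
    obtain \<sigma> where \<sigma>: "\<sigma> \<in> \<Sigma>" "x \<in> \<sigma>" using *(5) by blast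
    have "convex_cone hull {\<nu> 0} \<subseteq> convex_cone hull {\<nu> 0, \<nu> 1}" by (rule hull_mono) auto
    then have "\<sigma> \<subseteq> down_cone" if "\<nu> 0 \<in> \<sigma>"
      using fan_containing_nu_0[OF \<sigma>(1) that] subdivided_cone by auto
    then show ?thesis using \<sigma> unfolding down_fan_def by blast
  qed
  then show "\<Union>down_fan = UNIV" by blast
qed

lemma down_nu_eq_iff: "down_nu i = down_nu j \<longleftrightarrow> i mod int (n - 1) = j mod int (n - 1)"
proof
  define k l where "k = 1 + i mod int (n - 1)" and "l = 1 + j mod int (n - 1)"
  assume "down_nu i = down_nu j"
  then have "\<nu> k = \<nu> l" by (simp add: down_nu_def k_def l_def)
  moreover have "1 \<le> k" "k < int n" "1 \<le> l" "l < int n"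
    using mod_pred_n[of i] mod_pred_n[of j] unfolding k_def l_def by linarith+
  ultimately have "k = l" by (simp add: nu_eq_mod)
  then show "i mod int (n - 1) = j mod int (n - 1)" by (simp add: k_def l_def)
qed (simp add: down_nu_def)

text \<open>Written over index ranges, the old fan consists of a part that avoids
  \<open>\<nu> 0\<close> and three cones that contain it; the new one is that part together with
  \<open>down_cone\<close>.\<close>

lemma down_fan_eq: "down_fan = {{0}} \<union> range (\<lambda>i. convex_cone hull {down_nu i})
    \<union> range (\<lambda>i. convex_cone hull {down_nu i, down_nu (i + 1)})"
proof -
  have a: "{{0}} \<union> range (\<lambda>i. convex_cone hull {down_nu i})
    \<union> range (\<lambda>i. convex_cone hull {down_nu i, down_nu (i + 1)})
    = {{0}} \<union> (\<lambda>j. convex_cone hull {\<nu> j}) ` {1..<int n}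
      \<union> (\<lambda>j. convex_cone hull {\<nu> j, \<nu> (j + 1)}) ` {1..<int n - 1} \<union> {down_cone}"
    unfolding range_down_nu[of "\<lambda>x. convex_cone hull {x}"]
      range_down_nu_pairs[of "\<lambda>x y. convex_cone hull {x, y}"] down_cone_def by blast
  have eq: "\<Sigma> = {{0}} \<union> (\<lambda>j. convex_cone hull {\<nu> j}) ` {1..<int n}
      \<union> (\<lambda>j. convex_cone hull {\<nu> j, \<nu> (j + 1)}) ` {1..<int n - 1}
      \<union> {convex_cone hull {\<nu> 0}, convex_cone hull {\<nu> (-1), \<nu> 0}, convex_cone hull {\<nu> 0, \<nu> 1}}"
  proof -
    have "{0..<int n} = insert 0 {1..<int n}" using n_ge_4 by auto
    moreover have "range (\<lambda>j. convex_cone hull {\<nu> j}) = (\<lambda>j. convex_cone hull {\<nu> j}) ` {0..<int n}"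
      using arg_cong[OF range_nu, of "image (\<lambda>x. convex_cone hull {x})"] by (simp only: image_image)
    ultimately have "range (\<lambda>j. convex_cone hull {\<nu> j})
      = insert (convex_cone hull {\<nu> 0}) ((\<lambda>j. convex_cone hull {\<nu> j}) ` {1..<int n})" by simp
    then show ?thesis unfolding fan_eq range_nu_pairs_split[of "\<lambda>x y. convex_cone hull {x, y}"] by blast
  qed
  have 1: "\<nu> 0 \<notin> convex_cone hull {\<nu> j}" if "j \<in> {1..<int n}" for j
    using that middle_neq[of j] nu_in_ray[of 0 j] by auto
  have 2: "\<nu> 0 \<notin> convex_cone hull {\<nu> j, \<nu> (j + 1)}" if "j \<in> {1..<int n - 1}" for j
    using that middle_neq[of j] middle_neq[of "j + 1"] nu_in_cone[of 0 j] by auto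
  have 3: "\<nu> 0 \<in> convex_cone hull {\<nu> 0}" "\<nu> 0 \<in> convex_cone hull {\<nu> (-1), \<nu> 0}"
    "\<nu> 0 \<in> convex_cone hull {\<nu> 0, \<nu> 1}" by (simp_all add: hull_inc)
  have "{\<sigma> \<in> \<Sigma>. \<nu> 0 \<notin> \<sigma>} = {{0}} \<union> (\<lambda>j. convex_cone hull {\<nu> j}) ` {1..<int n}
      \<union> (\<lambda>j. convex_cone hull {\<nu> j, \<nu> (j + 1)}) ` {1..<int n - 1}"
    unfolding eq using 1 2 3 nu_nonzero[of 0] by blast
  then show ?thesis unfolding down_fan_def a by blast
qed

text \<open>In the relation at a neighbour of \<open>\<nu> 0\<close>, substituting
  \<open>\<nu> 0 = \<nu> (-1) + \<nu> 1\<close> produces one more copy of that neighbour, so its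
  weight rises by 1. All other relations are unchanged.\<close>

lemma down_weight:
  "down_nu (i - 1) + down_nu (i + 1) + of_int (wt down_graph (down_nu i)) *\<^sub>R down_nu i = 0"
proof -
  define r where "r = i mod int (n - 1)"
  have r: "0 \<le> r" "r < int n - 1" using mod_pred_n[of i] by (simp_all add: r_def)
  note step = down_nu_step[of i r, OF r_def[symmetric]]
  \<comment> \<open>The first two residues belong to \<open>\<nu> 1\<close> and
    \<open>\<nu> (-1)\<close>, where the numbering closes up.\<close>
  consider "r = 0" | "r = int n - 2" | "0 < r" "r < int n - 2" using r by linarith
  then show ?thesis
  proof cases
    case 1
    then show ?thesis
      using weight[of 1] step n_ge_4 neighbours_distinct
      by (simp add: down_graph_eq nu_0 algebra_simps)
  next
    case 2
    have "1 + r = int n - 1" "r = -2 + int n" "r \<noteq> 0" using 2 n_ge_4 by auto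
    then have "down_nu i = \<nu> (-1)" "down_nu (i + 1) = \<nu> 1" "down_nu (i - 1) = \<nu> (-2)"
      using step 2 nu_pred_n nu_add_n[of "-2"] by simp_all
    then show ?thesis
      using weight[of "-1"] neighbours_distinct
      by (simp add: down_graph_eq nu_0 algebra_simps)
  next
    case 3
    have "\<nu> (1 + r) \<noteq> \<nu> 0" "\<nu> (1 + r) \<noteq> \<nu> 1" "\<nu> (int n - 1) \<noteq> \<nu> (1 + r)"
      using 3 by (intro nu_neq; simp)+
    then show ?thesis using weight[of "1 + r"] step 3 nu_pred_n by (simp add: down_graph_eq)
  qed
qed

lemma circular_graph_down: "circular_graph down_graph down_fan (n - 1) down_nu"
proof
  show "complete_regular_fan down_fan" by (rule complete_regular_fan_down)
  show "cyclic_generators down_fan (n - 1) down_nu"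
    unfolding cyclic_generators_def
  proof (intro conjI allI)
    show "3 \<le> n - 1" using n_ge_4 by simp
    show "lattice_basis (down_nu i) (down_nu (i + 1))" for i
    proof -
      have "lattice_basis (down_nu i) (down_nu (i + 1))
        \<in> range (\<lambda>i. lattice_basis (down_nu i) (down_nu (i + 1)))" by blast
      then show ?thesis unfolding range_down_nu_pairs[of lattice_basis] using basis down_basis by auto
    qed
  qed (rule down_nu_eq_iff, rule down_fan_eq)
  show "verts down_graph = range down_nu"
  proof -
    have "\<nu> ` {0..<int n} = insert (\<nu> 0) (\<nu> ` {1..<int n})"
    proof -
      have "{0..<int n} = insert 0 {1..<int n}" using n_ge_4 by auto
      then show ?thesis by simp
    qed
    moreover have "\<nu> 0 \<notin> \<nu> ` {1..<int n}" using middle_neq by force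
    ultimately show ?thesis
      using range_down_nu[of "\<lambda>x. x"] by (simp add: down_graph_eq verts_eq range_nu)
  qed
  show "edges down_graph = range (\<lambda>i. {down_nu i, down_nu (i + 1)})"
  proof -
    have "{\<nu> j, \<nu> (j + 1)} \<notin> {{\<nu> (-1), \<nu> 0}, {\<nu> 0, \<nu> 1}}" if "j \<in> {1..<int n - 1}" for j
      using that middle_neq[of j] middle_neq[of "j + 1"] by (auto simp: doubleton_eq_iff)
    then show ?thesis
      unfolding range_down_nu_pairs[of "\<lambda>x y. {x, y}"] down_graph_eq edges_eq
        range_nu_pairs_split[of "\<lambda>x y. {x, y}"] by auto
  qed
  show "wt down_graph v = 0" if "v \<notin> verts down_graph" for v
  proof (cases "v = \<nu> 0")
    case False
    then have "v \<notin> verts \<Gamma>" using that by (simp add: down_graph_eq)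
    then show ?thesis using wt_outside verts_eq by (auto simp: down_graph_eq)
  qed (simp add: down_graph_eq)
qed (rule down_weight)

lemma blow_up_down: "blow_up down_graph (\<nu> (-1)) (\<nu> 1) = \<Gamma>" "{\<nu> (-1), \<nu> 1} \<in> edges down_graph"
proof -
  \<comment> \<open>In a triangle this pair would already be an edge, and blowing up again would
    delete it.\<close>
  have "{\<nu> (-1), \<nu> 1} \<notin> edges \<Gamma>"
  proof -
    have "\<nu> 1 \<noteq> \<nu> (-1 + 1)" "\<nu> 1 \<noteq> \<nu> (-1 - 1)" using n_ge_4 by (intro nu_neq; simp)+
    then show ?thesis unfolding edge_iff by blast
  qed
  moreover have "{\<nu> (-1), \<nu> 0} \<in> edges \<Gamma>" "{\<nu> 0, \<nu> 1} \<in> edges \<Gamma>"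
    using edge_iff[of "-1" 0] edge_iff[of 0 1] by simp_all
  ultimately have "edges (blow_up down_graph (\<nu> (-1)) (\<nu> 1)) = edges \<Gamma>"
    by (simp add: blow_up_def down_graph_eq flip: nu_0) blast
  moreover have "verts (blow_up down_graph (\<nu> (-1)) (\<nu> 1)) = verts \<Gamma>"
    by (simp add: blow_up_def down_graph_eq verts_eq insert_absorb flip: nu_0)
  moreover have "wt (blow_up down_graph (\<nu> (-1)) (\<nu> 1)) = wt \<Gamma>"
    using neighbours_distinct w_0 by (simp add: blow_up_def down_graph_eq fun_eq_iff flip: nu_0)
  ultimately show "blow_up down_graph (\<nu> (-1)) (\<nu> 1) = \<Gamma>" by (simp add: wgraph.equality)
  show "{\<nu> (-1), \<nu> 1} \<in> edges down_graph" by (simp add: down_graph_eq)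
qed

end

section \<open>Graphs with a unique vertex of weight -1\<close>

text \<open>The condition on each member of the sequence, in the form that the theorem states, and
  the invariant of the induction.\<close>

definition marked_graph :: "int \<Rightarrow> plane wgraph \<Rightarrow> bool" where
  "marked_graph a G \<longleftrightarrow> (\<exists>p x y.
     {v \<in> verts G. wt G v \<ge> -1} = {p, x, y} \<and>
     p \<noteq> x \<and> p \<noteq> y \<and> x \<noteq> y \<and>
     wt G p = -1 \<and>
     {x, y} \<in> edges G \<and>
     {wt G x, wt G y} = {0, a} \<and>
     {p, x} \<notin> edges G \<and> {p, y} \<notin> edges G)"

text \<open>For positive \<open>a\<close> the weights 0 and \<open>a\<close> differ from -1, which
  leaves only \<open>p\<close>.\<close>

lemma marked_graph_minus_one_unique:
  assumes "marked_graph a G" "1 \<le> a"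
    and "u \<in> verts G" "wt G u = -1" "v \<in> verts G" "wt G v = -1"
  shows "u = v"
proof -
  obtain p x y where *: "{v \<in> verts G. wt G v \<ge> -1} = {p, x, y}" "{wt G x, wt G y} = {0, a}"
    using assms(1) unfolding marked_graph_def by blast
  have "u \<in> {p, x, y}" "v \<in> {p, x, y}" using assms(3-) unfolding *(1)[symmetric] by auto
  moreover have "wt G x \<noteq> -1" "wt G y \<noteq> -1" using *(2) assms(2) by (auto simp: doubleton_eq_iff)
  ultimately show ?thesis using assms(4,6) by auto
qed

section \<open>Opposite generators and hexagons\<close>

context circular_graph
begin

text \<open>The relations at the two neighbours express \<open>\<nu> 2\<close> and
  \<open>\<nu> (-2)\<close> as the two differences of \<open>\<nu> 1\<close> and
  \<open>\<nu> (-1)\<close>.\<close>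

lemma two_neighbours_opposite:
  assumes "w 0 = -1" "w 1 = -2" "w (-1) = -2"
  shows "\<nu> (-2) = - \<nu> 2"
proof -
  have "\<nu> 0 = \<nu> (-1) + \<nu> 1" using weight[of 0] assms by simp
  then have "\<nu> 2 = \<nu> 1 - \<nu> (-1)" "\<nu> (-2) = \<nu> (-1) - \<nu> 1"
    using weight[of 1] weight[of "-1"] assms by (simp_all add: scaleR_2 algebra_simps)
  then show ?thesis by simp
qed

text \<open>The neighbours of \<open>\<nu> 3\<close> are opposite, which forces weight 0 there.
  Subtracting the relations at indices 2 and 4 eliminates \<open>\<nu> 3\<close> and leaves a
  multiple of \<open>\<nu> 2\<close>, whose coefficient ties \<open>w 4\<close> to
  \<open>w 2\<close>.\<close>

lemma hexagon_weights:
  assumes "n = 6" "w 0 = -1" "w 1 = -2" "w (-1) = -2"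
  shows "w 3 = 0" "w 4 = - w 2 - 1" "w 5 = -2"
proof -
  have nu: "\<nu> 4 = - \<nu> 2" "\<nu> 5 = \<nu> (-1)"
    using two_neighbours_opposite assms nu_add_n[of "-2"] nu_add_n[of "-1"] by simp_all
  show "w 5 = -2" using nu assms by simp
  have "of_int (w 3) *\<^sub>R \<nu> 3 = 0" using weight[of 3] nu by simp
  then show "w 3 = 0" using nu_nonzero[of 3] by simp
  have "\<nu> 0 = \<nu> (-1) + \<nu> 1" using weight[of 0] assms by simp
  then have "\<nu> 2 = \<nu> 1 - \<nu> (-1)" using weight[of 1] assms by (simp add: scaleR_2 algebra_simps)
  moreover define b where "b = w 4"
  have "\<nu> 3 + \<nu> (-1) = of_int b *\<^sub>R \<nu> 2"
    using weight[of 4, folded b_def] nu by (simp add: algebra_simps)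
  moreover have "\<nu> 1 + \<nu> 3 = - of_int (w 2) *\<^sub>R \<nu> 2"
    using weight[of 2] by (simp add: algebra_simps eq_neg_iff_add_eq_0)
  ultimately have "\<nu> 2 = - of_int (w 2) *\<^sub>R \<nu> 2 - of_int b *\<^sub>R \<nu> 2"
    by (metis add_diff_cancel_right add.commute)
  then have "of_int (1 + w 2 + b) *\<^sub>R \<nu> 2 = 0"
    by (simp add: algebra_simps eq_neg_iff_add_eq_0)
  then have "1 + w 2 + b = 0" using nu_nonzero[of 2] by (metis of_int_eq_0_iff scaleR_eq_0_iff)
  then show "w 4 = - w 2 - 1" by (simp add: b_def)
qed

text \<open>After removing \<open>\<nu> 0\<close> and then \<open>\<nu> 1\<close> the four remaining generators satisfy the equations
  of a fan with four rays, in which two opposite weights vanish.\<close>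

lemma hexagon_two:
  assumes "n = 6" "w 0 = -1" "w 1 = -2" "w 2 \<noteq> -1"
  shows "w (-1) = -2"
proof -
  have nu: "\<nu> 5 = \<nu> (-1)" "\<nu> 6 = \<nu> 0" using assms nu_add_n[of "-1"] nu_add_n[of 0] by simp_all
  have 0: "\<nu> 0 = \<nu> 5 + \<nu> 1" using weight[of 0] assms nu by simp
  then have 1: "\<nu> 1 = \<nu> 5 + \<nu> 2" using weight[of 1] assms by (simp add: scaleR_2 algebra_simps)
  \<comment> \<open>The weights at indices 2 and 5 after both removals: the first raises
    \<open>w 5\<close>, the second raises \<open>w 5\<close> and \<open>w 2\<close>.\<close>
  define c2 c5 where "c2 = w 2 + 1" and "c5 = w 5 + 2"
  have e2: "\<nu> 5 + \<nu> 3 = - of_int c2 *\<^sub>R \<nu> 2"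
    using weight[of 2] 1 by (simp add: c2_def algebra_simps eq_neg_iff_add_eq_0)
  have e3: "\<nu> 4 + \<nu> 2 = - of_int (w 3) *\<^sub>R \<nu> 3"
    using weight[of 3] by (simp add: algebra_simps eq_neg_iff_add_eq_0)
  have e5: "\<nu> 4 + \<nu> 2 = - of_int c5 *\<^sub>R \<nu> 5"
    using weight[of 5] 0 1 nu by (simp add: c5_def scaleR_2 algebra_simps eq_neg_iff_add_eq_0)
  have "cross (\<nu> 5) (\<nu> 0) = orient" using cross_Suc[of 5] nu by simp
  then have x52: "cross (\<nu> 5) (\<nu> 2) = orient" by (simp add: 0 1 cross_simps)
  \<comment> \<open>The vector \<open>\<nu> 4 + \<nu> 2\<close> is a multiple of
    \<open>\<nu> 3\<close> and of \<open>\<nu> 5\<close>, so it vanishes unless these two are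
    parallel. Parallel vectors would mean \<open>c2 = 0\<close>, that is
    \<open>w 2 = -1\<close>.\<close>
  have "of_int c5 * cross (\<nu> 5) (\<nu> 3) = - cross (\<nu> 4 + \<nu> 2) (\<nu> 3)" unfolding e5 by (simp add: cross_simps)
  also have "\<dots> = 0" unfolding e3 by (simp add: cross_simps)
  finally have "c5 = 0 \<or> cross (\<nu> 5) (\<nu> 3) = 0" by simp
  moreover have "cross (\<nu> 5) (\<nu> 3) \<noteq> 0"
  proof -
    have "cross (\<nu> 5) (\<nu> 3) = cross (\<nu> 5) (\<nu> 5 + \<nu> 3)" by (simp add: cross_simps)
    also have "\<dots> = - of_int c2 * orient" unfolding e2 by (simp add: cross_simps x52)
    finally show ?thesis using assms(4) orient_nonzero by (simp add: c2_def)
  qed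
  ultimately show ?thesis using nu by (simp add: c5_def)
qed

lemma hexagon_iso:
  assumes "n = 6" "w 0 = -1" "w 1 = -2" "w 2 = a" "w 3 = 0" "w 4 = - a - 1" "w 5 = -2"
  shows "wgraph_iso \<Gamma> (Gamma_graph a)"
proof -
  define g :: "nat \<Rightarrow> plane" where "g k = \<nu> (int k)" for k
  define f where "f = inv_into {..<6} g"
  have inj: "inj_on g {..<6}" by (auto simp: inj_on_def g_def nu_eq_mod assms(1))
  have "{0..<int 6} = int ` {..<6}" by (simp add: lessThan_atLeast0 image_int_atLeastLessThan)
  then have img: "g ` {..<6} = verts \<Gamma>"
    unfolding verts_eq range_nu assms(1) g_def by (simp only: image_image)
  have f: "f (g k) = k" if "k < 6" for k using that inj by (simp add: f_def inv_into_f_f)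
  have cases6: "k \<in> {0, 1, 2, 3, 4, 5}" if "k < 6" for k :: nat using that by auto
  have edge: "{g i, g j} \<in> edges \<Gamma> \<longleftrightarrow> {i, j} \<in> edges (Gamma_graph a)" if ij: "i < 6" "j < 6" for i j
  proof -
    have "{i, j} \<in> edges (Gamma_graph a) \<longleftrightarrow> j = (i + 1) mod 6 \<or> i = (j + 1) mod 6"
      using ij by (auto simp: Gamma_graph_def doubleton_eq_iff)
    moreover have "{g i, g j} \<in> edges \<Gamma> \<longleftrightarrow> j = (i + 1) mod 6 \<or> i = (j + 1) mod 6"
      unfolding g_def edge_iff nu_eq_mod assms(1) using cases6[OF ij(1)] cases6[OF ij(2)]
      by (elim insertE emptyE) simp_all
    ultimately show ?thesis by simp
  qed
  show ?thesis
    unfolding wgraph_iso_def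
  proof (intro exI[of _ f] conjI ballI)
    show "bij_betw f (verts \<Gamma>) (verts (Gamma_graph a))"
      unfolding f_def img[symmetric] using bij_betw_inv_into[OF inj_on_imp_bij_betw[OF inj]]
      by (simp add: Gamma_graph_def)
  next
    fix x y assume "x \<in> verts \<Gamma>" "y \<in> verts \<Gamma>"
    then obtain i j where "x = g i" "i < 6" "y = g j" "j < 6" unfolding img[symmetric] by auto
    then show "{x, y} \<in> edges \<Gamma> \<longleftrightarrow> {f x, f y} \<in> edges (Gamma_graph a)" using edge f by simp
  next
    fix x assume "x \<in> verts \<Gamma>"
    then obtain i where i: "x = g i" "i < 6" unfolding img[symmetric] by auto
    have "wt \<Gamma> (g i) = wt (Gamma_graph a) i"
      using cases6[OF i(2)] assms
      by (elim insertE emptyE) (simp_all add: g_def Gamma_graph_def)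
    then show "wt (Gamma_graph a) (f x) = wt \<Gamma> x" using i f by simp
  qed
qed

lemma hexagon_marked:
  assumes "n = 6" "w 0 = -1" "w 1 = -2" "w 2 = a" "w 3 = 0" "w 4 = - a - 1" "w 5 = -2" "1 \<le> a"
  shows "marked_graph a \<Gamma>"
  unfolding marked_graph_def
proof (intro exI conjI)
  have "{0..<int n} = {0, 1, 2, 3, 4, 5}" using assms(1) by auto
  then have "verts \<Gamma> = {\<nu> 0, \<nu> 1, \<nu> 2, \<nu> 3, \<nu> 4, \<nu> 5}" unfolding verts_eq range_nu by simp
  \<comment> \<open>As \<open>a >= 1\<close>, the weight \<open>- a - 1\<close> is below -1, like
    those at indices 1 and 5.\<close>
  then show "{v \<in> verts \<Gamma>. wt \<Gamma> v \<ge> -1} = {\<nu> 0, \<nu> 2, \<nu> 3}" using assms by auto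
  show "\<nu> 0 \<noteq> \<nu> 2" "\<nu> 0 \<noteq> \<nu> 3" "\<nu> 2 \<noteq> \<nu> 3" "wt \<Gamma> (\<nu> 0) = -1" "{\<nu> 2, \<nu> 3} \<in> edges \<Gamma>"
    "{w 2, w 3} = {0, a}" "{\<nu> 0, \<nu> 2} \<notin> edges \<Gamma>" "{\<nu> 0, \<nu> 3} \<notin> edges \<Gamma>"
    using assms by (auto simp: edge_iff nu_eq_mod)
qed

end

section \<open>Descent along blow-downs\<close>

locale unique_minus_one = blow_down +
  assumes unique: "w i = -1 \<Longrightarrow> \<nu> i = \<nu> 0"
begin

lemma reflected_unique: "unique_minus_one \<Gamma> \<Sigma> n (\<lambda>i. \<nu> (- i))"
proof -
  interpret r: circular_graph \<Gamma> \<Sigma> n "\<lambda>i. \<nu> (- i)" by (rule reflected)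
  show ?thesis
  proof unfold_locales
    show "r.w 0 = -1" using w_0 by simp
    show "\<nu> (- i) = \<nu> (- 0)" if "r.w i = -1" for i using unique[OF that] by simp
  qed (rule n_ge_4)
qed

text \<open>Only the two neighbours of \<open>\<nu> 0\<close> change their weight, each by 1, and no
  other old vertex had weight -1.\<close>

lemma wt_down_minus_one:
  assumes "v \<in> verts down_graph" "wt down_graph v = -1"
  shows "v = \<nu> 1 \<and> w 1 = -2 \<or> v = \<nu> (-1) \<and> w (-1) = -2"
proof -
  have "v \<in> verts \<Gamma>" "v \<noteq> \<nu> 0" using assms(1) by (auto simp: down_graph_eq)
  then have "wt \<Gamma> v \<noteq> -1" using unique unfolding verts_eq by blast
  then show ?thesis using assms(2) \<open>v \<noteq> \<nu> 0\<close> by (auto simp: down_graph_eq split: if_splits)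
qed

lemma ex_minus_two:
  assumes "6 \<le> n"
  shows "w 1 = -2 \<or> w (-1) = -2"
proof -
  interpret down: circular_graph down_graph down_fan "n - 1" down_nu by (rule circular_graph_down)
  obtain i where "down.w i = -1" using down.ex_minus_one assms by fastforce
  then show ?thesis using wt_down_minus_one[of "down_nu i"] down.verts_eq by blast
qed

text \<open>Otherwise \<open>\<nu> 2\<close> and \<open>\<nu> (n - 2)\<close> are opposite with
  \<open>n - 5\<close> generators between them on the side away from \<open>\<nu> 0\<close>. For
  \<open>n >= 7\<close> these are at least two, and one of them has weight -1.\<close>

lemma not_both_minus_two:
  assumes "7 \<le> n"
  shows "\<not> (w 1 = -2 \<and> w (-1) = -2)"
proof
  assume "w 1 = -2 \<and> w (-1) = -2"
  then have "\<nu> (-2 + int n) = - \<nu> 2" using two_neighbours_opposite w_0 nu_add_n[of "-2"] by simp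
  then obtain j where j: "2 < j" "j < -2 + int n" "w j = -1"
    using opposite_minus_one[of 2 "-2 + int n"] assms by auto
  then show False using unique[of j] middle_neq[of j] by simp
qed

text \<open>Exactly one neighbour of \<open>\<nu> 0\<close> rises from -2 to -1, so the hypothesis
  of the induction survives the blow-down.\<close>

lemma down_ex1_minus_one:
  assumes "7 \<le> n"
  shows "\<exists>!v. v \<in> verts down_graph \<and> wt down_graph v = -1"
proof -
  have "\<nu> 1 \<in> verts down_graph" "\<nu> (-1) \<in> verts down_graph"
    using neighbours_distinct by (auto simp: down_graph_eq verts_eq)
  moreover have "wt down_graph (\<nu> 1) = w 1 + 1" "wt down_graph (\<nu> (-1)) = w (-1) + 1"
    using neighbours_distinct by (auto simp: down_graph_eq)
  note down = calculation this
  consider "w 1 = -2" "w (-1) \<noteq> -2" | "w 1 \<noteq> -2" "w (-1) = -2"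
    using ex_minus_two not_both_minus_two assms by force
  then show ?thesis
  proof cases
    case 1
    then have "\<nu> 1 \<in> verts down_graph \<and> wt down_graph (\<nu> 1) = -1" using down by simp
    moreover have "v = \<nu> 1" if "v \<in> verts down_graph \<and> wt down_graph v = -1" for v
      using wt_down_minus_one[of v] that 1 by blast
    ultimately show ?thesis by blast
  next
    case 2
    then have "\<nu> (-1) \<in> verts down_graph \<and> wt down_graph (\<nu> (-1)) = -1" using down by simp
    moreover have "v = \<nu> (-1)" if "v \<in> verts down_graph \<and> wt down_graph v = -1" for v
      using wt_down_minus_one[of v] that 2 by blast
    ultimately show ?thesis by blast
  qed
qed

lemma hexagon:
  assumes "n = 6"
  shows "\<exists>a\<ge>1. wgraph_iso \<Gamma> (Gamma_graph a) \<and> marked_graph a \<Gamma>"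
proof -
  interpret r: unique_minus_one \<Gamma> \<Sigma> n "\<lambda>i. \<nu> (- i)" by (rule reflected_unique)
  have not1: "w 2 \<noteq> -1" "w (-2) \<noteq> -1"
    using unique[of 2] unique[of "-2"] nu_neq[of 2 0] nu_neq[of 0 "-2"] assms by auto
  have m1: "w 1 = -2" and m2: "w (-1) = -2"
    using ex_minus_two hexagon_two r.hexagon_two assms not1 w_0 by auto
  note weights = hexagon_weights[OF assms w_0 m1 m2]
  have "\<nu> 4 = \<nu> (-2)" using nu_add_n[of "-2"] assms by simp
  then have "w (-2) = - w 2 - 1" using weights by simp
  \<comment> \<open>The two weights add up to -1 and neither equals -1, so neither is 0 and one is
    positive. A reflection moves that one to index 2, where it serves as \<open>a\<close>.\<close>
  then consider "1 \<le> w 2" | "1 \<le> w (-2)" using not1 by linarith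
  then show ?thesis
  proof cases
    case 1
    then show ?thesis
      using hexagon_iso[OF assms w_0 m1 refl weights] hexagon_marked[OF assms w_0 m1 refl weights] by blast
  next
    case 2
    have "wt \<Gamma> (\<nu> (- 0)) = -1" "wt \<Gamma> (\<nu> (- 1)) = -2" "wt \<Gamma> (\<nu> (- (-1))) = -2"
      using w_0 m1 m2 by simp_all
    note r_weights = this(1,2) refl r.hexagon_weights[OF assms this]
    show ?thesis
      using 2 r.hexagon_iso[OF assms r_weights] r.hexagon_marked[OF assms r_weights] by blast
  qed
qed

text \<open>The edge to be blown up ends in \<open>p\<close>, the only vertex that can have weight
  -1 below. Its other end \<open>q\<close> is adjacent to \<open>p\<close>, hence is neither
  \<open>x\<close> nor \<open>y\<close> and has weight below -1. Both ends drop below -1 in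
  \<Gamma>, while \<open>x\<close> and \<open>y\<close> keep their weights and are not adjacent to
  the new vertex.\<close>

lemma marked_graph_blow_up:
  assumes n: "6 \<le> n" and a: "1 \<le> a" and marked: "marked_graph a down_graph"
  shows "marked_graph a \<Gamma>"
proof -
  let ?G = down_graph
  obtain p x y where pxy: "{v \<in> verts ?G. wt ?G v \<ge> -1} = {p, x, y}" "p \<noteq> x" "p \<noteq> y" "x \<noteq> y"
    "wt ?G p = -1" "{x, y} \<in> edges ?G" "{wt ?G x, wt ?G y} = {0, a}" "{p, x} \<notin> edges ?G" "{p, y} \<notin> edges ?G"
    using marked unfolding marked_graph_def by blast
  have in_verts: "p \<in> verts ?G" "x \<in> verts ?G" "y \<in> verts ?G" using pxy(1) by blast+
  have nb: "\<nu> 1 \<in> verts ?G" "\<nu> (-1) \<in> verts ?G" "{\<nu> (-1), \<nu> 1} \<in> edges ?G"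
    using neighbours_distinct by (auto simp: down_graph_eq verts_eq)
  have "p = \<nu> 1 \<or> p = \<nu> (-1)" using wt_down_minus_one in_verts(1) pxy(5) by blast
  then obtain q where q: "{p, q} = {\<nu> (-1), \<nu> 1}" by blast
  then have "p \<noteq> q" using neighbours_distinct by (auto simp: doubleton_eq_iff)
  have "q \<in> verts ?G" using q nb by (auto simp: doubleton_eq_iff)
  have "q \<noteq> x" "q \<noteq> y" using pxy(8,9) nb(3) unfolding q[symmetric] by auto
  then have "q \<notin> {v \<in> verts ?G. wt ?G v \<ge> -1}" unfolding pxy(1) using \<open>p \<noteq> q\<close> by blast
  then have wt_q: "wt ?G q < -1" using \<open>q \<in> verts ?G\<close> by auto
  have away: "x \<notin> {\<nu> (-1), \<nu> 1}" "y \<notin> {\<nu> (-1), \<nu> 1}"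
    unfolding q[symmetric] using pxy(2,3) \<open>q \<noteq> x\<close> \<open>q \<noteq> y\<close> by auto
  have ne0: "x \<noteq> \<nu> 0" "y \<noteq> \<nu> 0" using in_verts by (auto simp: down_graph_eq)
  have wt_same: "wt \<Gamma> v = wt ?G v" if "v \<notin> {\<nu> (-1), \<nu> 1}" "v \<noteq> \<nu> 0" for v
    using that by (simp add: down_graph_eq)
  have wt_nb: "wt \<Gamma> v < -1" if "v \<in> {\<nu> (-1), \<nu> 1}" for v
  proof -
    have "wt ?G v = wt \<Gamma> v + 1" using that neighbours_distinct by (auto simp: down_graph_eq)
    moreover have "wt ?G v \<le> -1" using that wt_q pxy(5) unfolding q[symmetric] by auto
    ultimately show ?thesis by simp
  qed
  have heavy: "{v \<in> verts \<Gamma>. wt \<Gamma> v \<ge> -1} = {\<nu> 0, x, y}"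
  proof (intro equalityI subsetI)
    fix v assume v: "v \<in> {v \<in> verts \<Gamma>. wt \<Gamma> v \<ge> -1}"
    show "v \<in> {\<nu> 0, x, y}"
    proof (cases "v = \<nu> 0")
      case False
      have nb: "v \<notin> {\<nu> (-1), \<nu> 1}" using v wt_nb by fastforce
      have "v \<in> verts ?G" using v False by (simp add: down_graph_eq)
      then have "v \<in> {v \<in> verts ?G. wt ?G v \<ge> -1}" using v wt_same[OF nb False] by simp
      moreover have "v \<noteq> p" using nb unfolding q[symmetric] by blast
      ultimately show ?thesis unfolding pxy(1) by blast
    qed simp
  next
    have "x \<in> {v \<in> verts ?G. wt ?G v \<ge> -1}" "y \<in> {v \<in> verts ?G. wt ?G v \<ge> -1}"
      unfolding pxy(1) by blast+
    moreover have "verts ?G \<subseteq> verts \<Gamma>" by (auto simp: down_graph_eq)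
    ultimately have "x \<in> {v \<in> verts \<Gamma>. wt \<Gamma> v \<ge> -1}" "y \<in> {v \<in> verts \<Gamma>. wt \<Gamma> v \<ge> -1}"
      using wt_same away ne0 by auto
    then show "v \<in> {v \<in> verts \<Gamma>. wt \<Gamma> v \<ge> -1}" if "v \<in> {\<nu> 0, x, y}" for v
      using that w_0 verts_eq by auto
  qed
  have no_edge: "{\<nu> 0, z} \<notin> edges \<Gamma>" if z: "z \<in> verts \<Gamma>" "z \<notin> {\<nu> (-1), \<nu> 1}" for z
    using z edge_iff[of 0] by (auto simp: verts_eq)
  have "x \<in> verts \<Gamma>" "y \<in> verts \<Gamma>" using heavy by blast+
  moreover have "{x, y} \<in> edges \<Gamma>"
    using pxy(6) away by (auto simp: down_graph_eq doubleton_eq_iff)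
  moreover have "{wt \<Gamma> x, wt \<Gamma> y} = {0, a}" using pxy(7) wt_same away ne0 by simp
  ultimately show ?thesis
    unfolding marked_graph_def using heavy ne0 pxy(4) w_0 no_edge away
    by (intro exI[of _ "\<nu> 0"] exI[of _ x] exI[of _ y]) auto
qed

end

lemma unique_minus_oneE:
  assumes "weighted_circular_graph \<Gamma>" "4 \<le> card (verts \<Gamma>)" "\<exists>!v. v \<in> verts \<Gamma> \<and> wt \<Gamma> v = -1"
  obtains \<Sigma> \<nu> where "unique_minus_one \<Gamma> \<Sigma> (card (verts \<Gamma>)) \<nu>"
proof -
  obtain \<Sigma> n \<mu> where "circular_graph \<Gamma> \<Sigma> n \<mu>"
    using assms(1) weighted_circular_graph_iff by blast
  then interpret \<mu>: circular_graph \<Gamma> \<Sigma> n \<mu> .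
  obtain k where k: "\<mu>.w k = -1" using assms(3) \<mu>.verts_eq by auto
  interpret \<nu>: circular_graph \<Gamma> \<Sigma> n "\<lambda>i. \<mu> (i + k)" by (rule \<mu>.shifted)
  have "unique_minus_one \<Gamma> \<Sigma> n (\<lambda>i. \<mu> (i + k))"
  proof unfold_locales
    show "4 \<le> n" using assms(2) \<mu>.card_verts by simp
    show "\<nu>.w 0 = -1" using k by simp
    show "\<nu>.w i = -1 \<Longrightarrow> \<mu> (i + k) = \<mu> (0 + k)" for i
      using k assms(3) unfolding \<mu>.verts_eq by (metis add_0 rangeI)
  qed
  then show thesis using that \<mu>.card_verts by simp
qed

section \<open>Blow-up sequences\<close>

text \<open>The sum lies in the cone of the edge but equals neither of its nonzero generators, and
  such a cone contains no other generators of the fan.\<close>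

lemma circular_edgeD:
  assumes "weighted_circular_graph G" "{u, v} \<in> edges G"
  shows "u \<noteq> v" "u \<in> verts G" "v \<in> verts G" "u + v \<notin> verts G"
proof -
  obtain \<Sigma> n \<nu> where "circular_graph G \<Sigma> n \<nu>" using assms(1) weighted_circular_graph_iff by blast
  then interpret circular_graph G \<Sigma> n \<nu> .
  obtain i where i: "{u, v} = {\<nu> i, \<nu> (i + 1)}" using assms(2) edges_eq by auto
  have neq: "\<nu> (i + 1) \<noteq> \<nu> i" using n_ge_3 by (intro nu_neq) auto
  show "u \<noteq> v" "u \<in> verts G" "v \<in> verts G" using i neq verts_eq by (auto simp: doubleton_eq_iff)
  have sum: "u + v = \<nu> i + \<nu> (i + 1)" using i by (auto simp: doubleton_eq_iff add.commute)
  show "u + v \<notin> verts G"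
  proof
    assume "u + v \<in> verts G"
    then obtain k where k: "\<nu> k = \<nu> i + \<nu> (i + 1)" unfolding verts_eq sum by auto
    then have "\<nu> k \<in> convex_cone hull {\<nu> i, \<nu> (i + 1)}" by (intro cone_hull_pairI[of _ 1 _ 1]) auto
    then show False using k nu_nonzero unfolding nu_in_cone by auto
  qed
qed

lemma circular_edge_subset:
  assumes "weighted_circular_graph G" "e \<in> edges G"
  shows "e \<subseteq> verts G"
  using assms unfolding weighted_circular_graph_def by auto

lemma circular_finite_verts: "weighted_circular_graph G \<Longrightarrow> finite (verts G)"
  using weighted_circular_graph_iff circular_graph.finite_verts by blast

text \<open>The new vertex is not in \<open>G\<close>, so its weight there is 0 by convention and
  none of its edges is an edge of \<open>G\<close>.\<close>

lemma undo_blow_up_blow_up: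
  assumes G: "weighted_circular_graph G" and e: "{u, v} \<in> edges G"
  shows "undo_blow_up (blow_up G u v) u v = G"
proof -
  note uv = circular_edgeD[OF G e]
  have "wt G (u + v) = 0" using G uv(4) unfolding weighted_circular_graph_def by blast
  then have "wt (undo_blow_up (blow_up G u v) u v) = wt G"
    using uv by (auto simp: undo_blow_up_def blow_up_def fun_eq_iff)
  moreover have "verts (undo_blow_up (blow_up G u v) u v) = verts G"
    using uv by (simp add: undo_blow_up_def blow_up_def)
  moreover have "edges (undo_blow_up (blow_up G u v) u v) = edges G"
  proof -
    have "{u, u + v} \<notin> edges G" "{u + v, v} \<notin> edges G"
      using circular_edge_subset[OF G] uv(4) by blast+
    then show ?thesis using e by (auto simp: undo_blow_up_def blow_up_def)
  qed
  ultimately show ?thesis by (simp add: wgraph.equality)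
qed

text \<open>Allows the blown-up edge to be read off from the result.\<close>

lemma new_vertex_neighbours:
  assumes "weighted_circular_graph G" "{u, v} \<in> edges G"
  shows "{x. {u + v, x} \<in> edges (blow_up G u v)} = {u, v}"
  using circular_edgeD[OF assms] circular_edge_subset[OF assms(1)]
  by (fastforce simp: blow_up_def doubleton_eq_iff)

text \<open>Each blow-up creates a vertex of weight -1, so the two new vertices coincide. Their
  neighbours determine the edge, and undoing the blow-up along it recovers the graph.\<close>

lemma is_blow_up_inj:
  assumes G: "weighted_circular_graph G" "is_blow_up G \<Gamma>"
    and G': "weighted_circular_graph G'" "is_blow_up G' \<Gamma>"
    and unique: "\<And>p q. p \<in> verts \<Gamma> \<Longrightarrow> wt \<Gamma> p = -1 \<Longrightarrow> q \<in> verts \<Gamma> \<Longrightarrow> wt \<Gamma> q = -1 \<Longrightarrow> p = q"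
  shows "G = G'"
proof -
  obtain u v where uv: "{u, v} \<in> edges G" "\<Gamma> = blow_up G u v" using G unfolding is_blow_up_def by blast
  obtain u' v' where uv': "{u', v'} \<in> edges G'" "\<Gamma> = blow_up G' u' v'"
    using G' unfolding is_blow_up_def by blast
  have sum: "u + v = u' + v'"
  proof (rule unique)
    show "u + v \<in> verts \<Gamma>" "wt \<Gamma> (u + v) = -1" unfolding uv(2) by (simp_all add: blow_up_def)
    show "u' + v' \<in> verts \<Gamma>" "wt \<Gamma> (u' + v') = -1" unfolding uv'(2) by (simp_all add: blow_up_def)
  qed
  have "{u, v} = {u', v'}"
    using new_vertex_neighbours[OF G(1) uv(1)] new_vertex_neighbours[OF G'(1) uv'(1)]
    unfolding uv(2)[symmetric] uv'(2)[symmetric] sum by simp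
  \<comment> \<open>Equality of edges leaves the order of the end points open.\<close>
  moreover have "undo_blow_up \<Gamma> u v = undo_blow_up \<Gamma> v u"
    using circular_edgeD(1)[OF G(1) uv(1)]
    by (simp add: undo_blow_up_def add.commute insert_commute fun_upd_twist)
  ultimately have "undo_blow_up \<Gamma> u v = undo_blow_up \<Gamma> u' v'" by (auto simp: doubleton_eq_iff)
  then show ?thesis
    using undo_blow_up_blow_up[OF G(1) uv(1)] undo_blow_up_blow_up[OF G'(1) uv'(1)]
    unfolding uv(2)[symmetric] uv'(2)[symmetric] by simp
qed

section \<open>Length, uniqueness and existence of blow-up sequences\<close>

lemma blow_up_sequence_card:
  assumes "blow_up_sequence a Gs \<Gamma>" "l < length Gs"
  shows "card (verts (Gs ! l)) = 6 + l"
  using assms(2)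
proof (induction l)
  case 0
  have "wgraph_iso (Gs ! 0) (Gamma_graph a)"
    using assms(1) unfolding blow_up_sequence_def by (auto simp: hd_conv_nth)
  then obtain f where "bij_betw f (verts (Gs ! 0)) {..<6::nat}"
    unfolding wgraph_iso_def by (auto simp: Gamma_graph_def)
  then show ?case by (simp add: bij_betw_same_card)
next
  case (Suc l)
  have circ: "weighted_circular_graph (Gs ! l)" and "is_blow_up (Gs ! l) (Gs ! Suc l)"
    using assms(1) Suc.prems unfolding blow_up_sequence_def by auto
  then obtain u v where uv: "{u, v} \<in> edges (Gs ! l)" "Gs ! Suc l = blow_up (Gs ! l) u v"
    unfolding is_blow_up_def by blast
  then show ?case
    using Suc circular_edgeD(4)[OF circ uv(1)] circular_finite_verts[OF circ] by (simp add: blow_up_def)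
qed

text \<open>Every blow-up adds one vertex to the initial six. Two sequences for the same graph thus
  have equal length and can be compared from their common end.\<close>

lemma blow_up_sequence_length:
  assumes "blow_up_sequence a Gs \<Gamma>"
  shows "length Gs = card (verts \<Gamma>) - 5"
proof -
  have "Gs \<noteq> []" "last Gs = \<Gamma>" using assms unfolding blow_up_sequence_def by auto
  then have "card (verts \<Gamma>) = 6 + (length Gs - 1)" "0 < length Gs"
    using blow_up_sequence_card[OF assms, of "length Gs - 1"] by (auto simp: last_conv_nth)
  then show ?thesis by simp
qed

text \<open>Backward from the last graph, \<open>is_blow_up_inj\<close> identifies the predecessors;
  the marking of \<open>Gs\<close> provides the unique vertex of weight -1.\<close>

lemma blow_up_sequence_unique:
  assumes Gs: "blow_up_sequence a Gs \<Gamma>" and Gs': "blow_up_sequence a Gs' \<Gamma>" and a: "1 \<le> a"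
    and marked: "\<And>l. l < length Gs \<Longrightarrow> marked_graph a (Gs ! l)"
  shows "Gs' = Gs"
proof (rule nth_equalityI)
  show len: "length Gs' = length Gs"
    using blow_up_sequence_length[OF Gs] blow_up_sequence_length[OF Gs'] by simp
  \<comment> \<open>Here \<open>k\<close> counts the steps back from the end.\<close>
  have eq: "Gs' ! (length Gs - Suc k) = Gs ! (length Gs - Suc k)" if "k < length Gs" for k
    using that
  proof (induction k)
    case 0
    have "last Gs' = last Gs" "Gs \<noteq> []" "Gs' \<noteq> []"
      using Gs Gs' unfolding blow_up_sequence_def by auto
    then show ?case by (simp add: last_conv_nth len)
  next
    case (Suc k)
    define l where "l = length Gs - Suc (Suc k)"
    have l: "length Gs - Suc k = Suc l" "Suc l < length Gs" using Suc.prems by (auto simp: l_def)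
    have same: "Gs' ! Suc l = Gs ! Suc l" using Suc l(1) by simp
    have "Gs' ! l = Gs ! l"
    proof (rule is_blow_up_inj)
      show "weighted_circular_graph (Gs ! l)" "is_blow_up (Gs ! l) (Gs ! Suc l)"
        using Gs l unfolding blow_up_sequence_def by auto
      show "weighted_circular_graph (Gs' ! l)" "is_blow_up (Gs' ! l) (Gs ! Suc l)"
        using Gs' l len unfolding blow_up_sequence_def same[symmetric] by auto
    qed (rule marked_graph_minus_one_unique[OF marked[OF l(2)] a])
    then show ?case by (simp add: l_def)
  qed
  show "Gs' ! i = Gs ! i" if "i < length Gs'" for i
    using eq[of "length Gs - Suc i"] that len by simp
qed

text \<open>Induction on the number of vertices: the sequence of the blown down graph is extended by
  \<Gamma>. The integer \<open>a\<close> is found in the hexagon and then stays fixed.\<close>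

lemma ex_blow_up_sequence:
  assumes "weighted_circular_graph \<Gamma>" "card (verts \<Gamma>) = n" "6 \<le> n"
    and "\<exists>!v. v \<in> verts \<Gamma> \<and> wt \<Gamma> v = -1"
  shows "\<exists>a\<ge>1. \<exists>Gs. blow_up_sequence a Gs \<Gamma> \<and> (\<forall>l < length Gs. marked_graph a (Gs ! l))"
  using assms(3,1,2,4)
proof (induction n arbitrary: \<Gamma> rule: nat_induct_at_least)
  case base
  obtain \<Sigma> \<nu> where "unique_minus_one \<Gamma> \<Sigma> 6 \<nu>" using unique_minus_oneE[OF base(1) _ base(3)] base(2) by auto
  then obtain a where a: "1 \<le> a" "wgraph_iso \<Gamma> (Gamma_graph a)" "marked_graph a \<Gamma>"
    using unique_minus_one.hexagon by blast
  then have "blow_up_sequence a [\<Gamma>] \<Gamma>" using base by (simp add: blow_up_sequence_def)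
  then show ?case using a by (intro exI[of _ a] conjI exI[of _ "[\<Gamma>]"]) auto
next
  case (Suc n)
  obtain \<Sigma> \<nu> where u: "unique_minus_one \<Gamma> \<Sigma> (Suc n) \<nu>"
    using unique_minus_oneE[OF Suc.prems(1) _ Suc.prems(3)] Suc.prems(2) Suc.hyps by auto
  interpret unique_minus_one \<Gamma> \<Sigma> "Suc n" \<nu> by (rule u)
  interpret down: circular_graph down_graph down_fan "Suc n - 1" down_nu by (rule circular_graph_down)
  have circ: "weighted_circular_graph down_graph"
    using weighted_circular_graph_iff down.circular_graph_axioms by blast
  have "card (verts down_graph) = n" using down.card_verts by simp
  then obtain a Gs where a: "1 \<le> a" and Gs: "blow_up_sequence a Gs down_graph"
    and marked: "\<forall>l < length Gs. marked_graph a (Gs ! l)"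
    using Suc.IH[OF circ] down_ex1_minus_one Suc.hyps by auto
  have ne: "Gs \<noteq> []" "last Gs = down_graph" using Gs by (auto simp: blow_up_sequence_def)
  have "is_blow_up down_graph \<Gamma>" using blow_up_down unfolding is_blow_up_def by metis
  then have "is_blow_up ((Gs @ [\<Gamma>]) ! l) ((Gs @ [\<Gamma>]) ! Suc l)" if "Suc l < length (Gs @ [\<Gamma>])" for l
  proof (cases "Suc l < length Gs")
    case True
    then show ?thesis using Gs by (simp add: blow_up_sequence_def nth_append)
  next
    case False
    then have "l = length Gs - 1" "Suc l = length Gs" using that by auto
    then show ?thesis using ne \<open>is_blow_up down_graph \<Gamma>\<close> by (simp add: nth_append last_conv_nth)
  qed
  then have "blow_up_sequence a (Gs @ [\<Gamma>]) \<Gamma>"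
    using Gs ne Suc.prems(1) unfolding blow_up_sequence_def by auto
  moreover have "marked_graph a down_graph"
    using marked ne by (metis last_conv_nth diff_less length_greater_0_conv zero_less_one)
  then have "marked_graph a \<Gamma>" using marked_graph_blow_up a Suc.hyps by simp
  then have "\<forall>l < length (Gs @ [\<Gamma>]). marked_graph a ((Gs @ [\<Gamma>]) ! l)"
    using marked by (auto simp: nth_append less_Suc_eq)
  ultimately show ?case using a by blast
qed

theorem theorem2p9:
  fixes \<Gamma> :: "plane wgraph" and n :: nat
  assumes "weighted_circular_graph \<Gamma>"
    and "card (verts \<Gamma>) = n"
    and "n \<ge> 6"
    and "\<exists>!v. v \<in> verts \<Gamma> \<and> wt \<Gamma> v = -1"
  shows "\<exists>a::int. a \<ge> 1 \<and>
    ((n = 6 \<and> wgraph_iso \<Gamma> (Gamma_graph a)) \<or>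
     (n \<ge> 7 \<and>
      (\<exists>Gs. blow_up_sequence a Gs \<Gamma> \<and> length Gs = n - 5 \<and>
        (\<forall>Gs'. blow_up_sequence a Gs' \<Gamma> \<longrightarrow> Gs' = Gs) \<and>
        (\<forall>l \<le> n - 6. \<exists>p x y.
           {v \<in> verts (Gs ! l). wt (Gs ! l) v \<ge> -1} = {p, x, y} \<and>
           p \<noteq> x \<and> p \<noteq> y \<and> x \<noteq> y \<and>
           wt (Gs ! l) p = -1 \<and>
           {x, y} \<in> edges (Gs ! l) \<and>
           {wt (Gs ! l) x, wt (Gs ! l) y} = {0, a} \<and>
           {p, x} \<notin> edges (Gs ! l) \<and> {p, y} \<notin> edges (Gs ! l)))))"
proof -
  obtain a Gs where a: "1 \<le> a" and Gs: "blow_up_sequence a Gs \<Gamma>"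
    and marked: "\<And>l. l < length Gs \<Longrightarrow> marked_graph a (Gs ! l)"
    using ex_blow_up_sequence[OF assms(1-4)] by blast
  have len: "length Gs = n - 5" using blow_up_sequence_length[OF Gs] assms(2) by simp
  show ?thesis
  proof (cases "n = 6")
    case True
    \<comment> \<open>A sequence of length one consists of \<Gamma> alone, so its initial
      isomorphism is the one wanted.\<close>
    then have "length Gs = 1" using len by simp
    then have "Gs = [\<Gamma>]" using Gs by (auto simp: blow_up_sequence_def length_Suc_conv)
    then have "wgraph_iso \<Gamma> (Gamma_graph a)" using Gs by (simp add: blow_up_sequence_def)
    then show ?thesis using True a by blast
  next
    case False
    show ?thesis
    proof (intro exI[of _ a] conjI disjI2 exI[of _ Gs] allI impI)
      show "7 \<le> n" using assms(3) False by simp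
      show "Gs' = Gs" if "blow_up_sequence a Gs' \<Gamma>" for Gs'
        using Gs that a marked by (rule blow_up_sequence_unique)
    next
      fix l assume "l \<le> n - 6"
      \<comment> \<open>The last admissible index is \<open>n - 6\<close>, one less than the length
        \<open>n - 5\<close>.\<close>
      then have "marked_graph a (Gs ! l)" using assms(3) by (intro marked) (simp add: len)
      then show "\<exists>p x y.
           {v \<in> verts (Gs ! l). wt (Gs ! l) v \<ge> -1} = {p, x, y} \<and>
           p \<noteq> x \<and> p \<noteq> y \<and> x \<noteq> y \<and>
           wt (Gs ! l) p = -1 \<and>
           {x, y} \<in> edges (Gs ! l) \<and>
           {wt (Gs ! l) x, wt (Gs ! l) y} = {0, a} \<and>
           {p, x} \<notin> edges (Gs ! l) \<and> {p, y} \<notin> edges (Gs ! l)"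
        by (simp only: marked_graph_def)
    qed (fact a Gs len)+
  qed
qed

end
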